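(* Let $\{Y_{n,1},\dots,Y_{n,2n}\}_{n\ge 1}$ be a triangular array of random vectors, $Y_{n,i}\in\mathbb{R}^{p_n}$ (written $Y_1,\dots,Y_{2n}$), let $\hat m=\hat m(Y_1^n)$ be a $\sigma(Y_1,\dots,Y_n)$-measurable selected model with values in a collection $\mathcal{M}$, and for each $m\in\mathcal{M}$ let $\hat\theta_m(\cdot)$ be an estimator with values in $\Theta_m$. Suppose there exists $\mathcal{M}^*\subseteq\mathcal{M}$ with $|\mathcal{M}^*|<\infty$ and $P(\hat m\in\mathcal{M}^* )\to 1$. For each $m\in\mathcal{M}^*$, assume there exists a sequence of positive integers $i_n\to\infty$ ($i_n<n$) such that: (A1) $\{\hat\theta_m(Y_{n+i_n+1}^{2n})\}_{n\ge1}$ is tight; (A2) $|\hat\theta_m(Y_{n+1}^{2n})-\hat\theta_m(Y_{n+i_n+1}^{2n})|=o_P(1)$. In addition, assume that one of the following two conditions holds (with the same sequences $i_n$): (T) for each $m\in\mathcal{M}^*$, $(n-i_n)\cdot\tau_{i_n}(Y_1^{2n})\cdot\|\hat\theta_m(Y_{n+i_n+1}^{2n})\|_L\to 0$, where $\|\cdot\|_L$ is the Lipschitz constant of the map $Y_{n+i_n+1}^{2n}\mapsto\hat\theta_m(Y_{n+i_n+1}^{2n})$; (B) for each $m\in\mathcal{M}^*$, $\hat\theta_m(Y_{n+i_n+1}^{2n})$ is measurable and $\beta_{i_n}(Y_1^{2n})\to0$. Then $$d_{BL}\Big(\mathcal{L}\big(\hat\theta_{\hat m}(Y_{n+1}^{2n})\mid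 Y_1^n\big),\ \mathcal{L}\big(\hat\theta_{\hat m}(\widetilde Y_{n+1}^{2n})\mid Y_1^n\big)\Big)\xrightarrow{P}0,$$ where $\widetilde Y_{n+1}^{2n}$ is a copy of $Y_{n+1}^{2n}$ (same distribution) that is independent of $Y_1^{2n}$.
   Context: Notation: $Y_a^b=(Y_a,\dots,Y_b)$. For each model $m$ and each sample length, $\hat\theta_m$ is a function of the sample (of the coordinates used by model $m$) with values in a Polish space $\Theta_m$; $|a-b|$ denotes the distance in $\Theta_m$ (the sup-norm distance when $\Theta_m\subseteq\mathbb{R}^k$). $\hat\theta_{\hat m}$ denotes $\hat\theta_m$ on the event $\{\hat m=m\}$. $\mathcal{L}(\cdot\mid\cdot)$ denotes a regular conditional distribution. Lipschitz constants: a map $f$ between metric spaces has Lipschitz constant $\|f\|_L$, the smallest $K$ with $\rho'(f(x),f(y))\le K\rho(x,y)$; products of Euclidean spaces carry the sup-norm $\|\cdot\|_\infty$. Bounded Lipschitz metric: $d_{BL}(P,Q)=\sup\{\int f\,d(P-Q): f \text{ real-valued},\ \|f\|_\infty\vee\|f\|_L\le1\}$. $\beta$-mixing: for sub-$\sigma$-fields $\mathcal{A},\mathcal{B}$, $\beta(\mathcal{A},\mathcal{B})=\frac12\sup\sum_{i}\sum_j|P(A_i\cap B_j)-P(A_i)P(B_j)|$ over finite partitions $\{A_i\}\subset\mathcal{A}$, $\{B_j\}\subset\mathcal{B}$ of $\Omega$; $\beta_r(Y_1^{2n})=\max_{1\le l\le 2n-r}\beta(\sigma(Y_1,\dots,Y_l),\sigma(Y_{l+r},\dots,Y_{2n}))$.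 $\tau$-coefficient: with $d_W(P,Q)=\sup_{\|f\|_L\le1}\int f\,d(P-Q)$, for an integrable random element $X$ and $\sigma$-field $\mathcal{E}$, $\tau(\mathcal{E},X)=\|d_W(\mathcal{L}(X\mid\mathcal{E}),\mathcal{L}(X))\|_1$ ($L_1$ norm); $\tau_r(Y_1^{2n})=\max_{1\le l\le2n-r}\max_{v}\frac1{|v|}\tau(\sigma(Y_1,\dots,Y_l),(Y_j)_{j\in v})$, the inner maximum over non-empty $v\subseteq\{l+r,\dots,2n\}$. Under condition (T) the $Y_i$ are integrable. *)

theory Defs
  imports "HOL-Probability.Probability"
begin

section \<open>Metric spaces\<close>

definition borel_alg :: "'a metric \<Rightarrow> 'a measure" where
  "borel_alg T = sigma (mspace T) {U. openin (mtopology_of T) U}"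

text \<open>The topology is Polish; the given metric is a compatible one and need not itself be complete
  (think of an open subset of a Euclidean space with the sup-norm distance).\<close>

definition polish_metric :: "'a metric \<Rightarrow> bool" where
  "polish_metric T \<longleftrightarrow> completely_metrizable_space (mtopology_of T) \<and> second_countable (mtopology_of T)"

text \<open>The value is \<^term>\<open>top\<close> when the map is not Lipschitz.\<close>

definition lip_const :: "'a metric \<Rightarrow> 'b metric \<Rightarrow> ('a \<Rightarrow> 'b) \<Rightarrow> ennreal" where
  "lip_const S T f =
    (INF C\<in>{C::real. 0 \<le> C \<and> (\<forall>x\<in>mspace S. \<forall>y\<in>mspace S. mdist T (f x) (f y) \<le> C * mdist S x y)}.
      ennreal C)"

definition d_BL :: "'a metric \<Rightarrow> 'a measure \<Rightarrow> 'a measure \<Rightarrow> real" where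
  "d_BL T P Q =
    (SUP f\<in>{f :: 'a \<Rightarrow> real. (\<forall>x\<in>mspace T. \<bar>f x\<bar> \<le> 1) \<and> lip_const T euclidean_metric f \<le> 1}.
      (\<integral>x. f x \<partial>P) - (\<integral>x. f x \<partial>Q))"

definition d_W :: "'a metric \<Rightarrow> 'a measure \<Rightarrow> 'a measure \<Rightarrow> ennreal" where
  "d_W T P Q =
    (SUP f\<in>{f :: 'a \<Rightarrow> real. lip_const T euclidean_metric f \<le> 1}.
      ennreal ((\<integral>x. f x \<partial>P) - (\<integral>x. f x \<partial>Q)))"


section \<open>Samples\<close>

text \<open>A vector in dimension \<open>p\<close> is an extensional function on \<open>{1..p}\<close>, and a family of such vectors
  indexed by a finite set \<open>I\<close> is an extensional function on \<open>I\<close>. On finite index sets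
  \<^const>\<open>funspace\<close> is the full product with the sup distance, so \<open>vecs_metric p I\<close> carries the
  maximum of the coordinate distances over all \<open>j \<in> I\<close> and \<open>c \<in> {1..p}\<close>.\<close>

definition vec_alg :: "nat \<Rightarrow> (nat \<Rightarrow> real) measure" where
  "vec_alg p = PiM {1..p} (\<lambda>_. borel)"

definition vecs_alg :: "nat \<Rightarrow> nat set \<Rightarrow> (nat \<Rightarrow> nat \<Rightarrow> real) measure" where
  "vecs_alg p I = PiM I (\<lambda>_. vec_alg p)"

definition vecs_metric :: "nat \<Rightarrow> nat set \<Rightarrow> (nat \<Rightarrow> nat \<Rightarrow> real) metric" where
  "vecs_metric p I = funspace I (funspace {1..p} euclidean_metric)"

lemma mspace_funspace_finite:
  assumes "finite I"
  shows "mspace (funspace I m) = (\<Pi>\<^sub>E j\<in>I. mspace m)"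
proof -
  have "Metric_space.mbounded (mspace m) (mdist m) (f ` I)" if "f ` I \<subseteq> mspace m" for f
    using assms that
    by (intro Metric_space.compactin_imp_mbounded finite_imp_compactin)
       (auto simp: Metric_space.topspace_mtopology)
  then show ?thesis
    by (auto simp: Metric_space.fspace_def PiE_def)
qed

lemma mspace_vecs_metric:
  assumes "finite I"
  shows "mspace (vecs_metric p I) = space (vecs_alg p I)"
  using assms
  by (simp add: vecs_metric_def vecs_alg_def vec_alg_def space_PiM mspace_funspace_finite
      del: mspace_funspace)

definition block :: "(nat \<Rightarrow> 'w \<Rightarrow> nat \<Rightarrow> real) \<Rightarrow> nat set \<Rightarrow> 'w \<Rightarrow> nat \<Rightarrow> nat \<Rightarrow> real" where
  "block Y I \<omega> = (\<lambda>j\<in>I. Y j \<omega>)"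

text \<open>\<open>sample Y a k\<close> is the sample \<open>Y (a+1), \<dots>, Y (a+k)\<close>, reindexed by \<open>{1..k}\<close>.\<close>

definition sample :: "(nat \<Rightarrow> 'w \<Rightarrow> nat \<Rightarrow> real) \<Rightarrow> nat \<Rightarrow> nat \<Rightarrow> 'w \<Rightarrow> nat \<Rightarrow> nat \<Rightarrow> real" where
  "sample Y a k \<omega> = (\<lambda>j\<in>{1..k}. Y (a + j) \<omega>)"

definition sigma_gen ::
  "'w measure \<Rightarrow> nat \<Rightarrow> (nat \<Rightarrow> 'w \<Rightarrow> nat \<Rightarrow> real) \<Rightarrow> nat set \<Rightarrow> 'w measure" where
  "sigma_gen M p Y I = vimage_algebra (space M) (block Y I) (vecs_alg p I)"


section \<open>Conditional distributions\<close>

text \<open>\<open>K\<close> is a version of the regular conditional distribution of \<open>X\<close> (with values in \<open>S\<close>) given \<open>F\<close>.\<close>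

definition is_rcd ::
  "'w measure \<Rightarrow> 'w measure \<Rightarrow> 'b measure \<Rightarrow> ('w \<Rightarrow> 'b) \<Rightarrow> ('w \<Rightarrow> 'b measure) \<Rightarrow> bool" where
  "is_rcd M F S X K \<longleftrightarrow>
     K \<in> F \<rightarrow>\<^sub>M prob_algebra S \<and>
     (\<forall>A\<in>sets F. \<forall>B\<in>sets S. emeasure M (A \<inter> X -` B) = (\<integral>\<^sup>+\<omega>\<in>A. emeasure (K \<omega>) B \<partial>M))"

text \<open>Here the space in which \<open>X\<close> takes its values depends on an \<open>F\<close>-measurable label: on the event
  \<open>{h = m}\<close> the variable \<open>X\<close> lives in \<open>\<Theta> m\<close>, and so does the conditional distribution \<open>K\<close>.\<close>

definition is_rcd_selected ::
  "'w measure \<Rightarrow> 'w measure \<Rightarrow> 'm set \<Rightarrow> ('w \<Rightarrow> 'm) \<Rightarrow> ('m \<Rightarrow> 'b metric) \<Rightarrow> ('w \<Rightarrow> 'b) \<Rightarrow>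
    ('w \<Rightarrow> 'b measure) \<Rightarrow> bool" where
  "is_rcd_selected M F \<M> h \<Theta> X K \<longleftrightarrow>
     (\<forall>m\<in>\<M>. is_rcd (restrict_space M {\<omega>. h \<omega> = m}) (restrict_space F {\<omega>. h \<omega> = m})
       (borel_alg (\<Theta> m)) X K)"


section \<open>Dependence coefficients\<close>

definition beta_coeff :: "'w measure \<Rightarrow> 'w measure \<Rightarrow> 'w measure \<Rightarrow> real" where
  "beta_coeff M F G =
    (1/2) * (SUP (A, B)\<in>{(A, B). finite A \<and> A \<subseteq> sets F \<and> partition_on (space M) A \<and>
                                  finite B \<and> B \<subseteq> sets G \<and> partition_on (space M) B}.
      \<Sum>a\<in>A. \<Sum>b\<in>B. \<bar>measure M (a \<inter> b) - measure M a * measure M b\<bar>)"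

text \<open>The integral does not depend on the version of the conditional distribution, so the infimum
  merely selects the common value.\<close>

definition tau_coeff ::
  "'w measure \<Rightarrow> 'w measure \<Rightarrow> 'b metric \<Rightarrow> 'b measure \<Rightarrow> ('w \<Rightarrow> 'b) \<Rightarrow> ennreal" where
  "tau_coeff M E T S X = (INF K\<in>{K. is_rcd M E S X K}. \<integral>\<^sup>+\<omega>. d_W T (K \<omega>) (distr M S X) \<partial>M)"

text \<open>In the next two definitions \<open>N\<close> is the length of the whole sequence and \<open>r\<close> the lag.\<close>

definition beta_mix :: "'w measure \<Rightarrow> nat \<Rightarrow> (nat \<Rightarrow> 'w \<Rightarrow> nat \<Rightarrow> real) \<Rightarrow> nat \<Rightarrow> nat \<Rightarrow> real" where
  "beta_mix M p Y N r =
    (MAX l\<in>{1..N - r}. beta_coeff M (sigma_gen M p Y {1..l}) (sigma_gen M p Y {l + r..N}))"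

definition tau_mix :: "'w measure \<Rightarrow> nat \<Rightarrow> (nat \<Rightarrow> 'w \<Rightarrow> nat \<Rightarrow> real) \<Rightarrow> nat \<Rightarrow> nat \<Rightarrow> ennreal" where
  "tau_mix M p Y N r =
    (MAX l\<in>{1..N - r}. MAX v\<in>{v. v \<subseteq> {l + r..N} \<and> v \<noteq> {}}.
      tau_coeff M (sigma_gen M p Y {1..l}) (vecs_metric p v) (vecs_alg p v) (block Y v)
        / of_nat (card v))"


section \<open>Asymptotics\<close>

text \<open>Convergence in probability to zero on a sequence of probability spaces. The exceptional sets
  are covered by events (that is, outer probability is used), because \<^const>\<open>measure\<close> is silently zero
  on non-measurable sets.\<close>

definition conv_in_prob_0 :: "(nat \<Rightarrow> 'w measure) \<Rightarrow> (nat \<Rightarrow> 'w \<Rightarrow> real) \<Rightarrow> bool" where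
  "conv_in_prob_0 M X \<longleftrightarrow>
    (\<forall>\<epsilon>>0. \<exists>N. (\<forall>n. N n \<in> sets (M n) \<and> {\<omega>\<in>space (M n). \<epsilon> < \<bar>X n \<omega>\<bar>} \<subseteq> N n) \<and>
      (\<lambda>n. measure (M n) (N n)) \<longlonglongrightarrow> 0)"

text \<open>Tightness of \<open>X n\<close> for \<open>n \<in> I\<close>. The lower bound is on \<open>{X n \<in> C}\<close>, which has
  \<^const>\<open>measure\<close> zero when it is not measurable, so non-measurability cannot make it hold vacuously.\<close>

definition tight_family ::
  "nat set \<Rightarrow> (nat \<Rightarrow> 'w measure) \<Rightarrow> 'b metric \<Rightarrow> (nat \<Rightarrow> 'w \<Rightarrow> 'b) \<Rightarrow> bool" where
  "tight_family I M T X \<longleftrightarrow>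
    (\<forall>\<epsilon>>0. \<exists>C. compactin (mtopology_of T) C \<and>
      (\<forall>n\<in>I. measure (M n) {\<omega>\<in>space (M n). X n \<omega> \<in> C} \<ge> 1 - \<epsilon>))"

end

theory Submission
  imports Defs
begin

text \<open>
  Fix a model \<open>m\<close>. Let \<open>X\<close> be its estimator on the second half of the sample, \<open>X'\<close> the estimator
  after a further gap of \<open>i m n\<close> observations, and \<open>Xt\<close> the estimator on the independent copy.
  Given the first half, the conditional law of \<open>Xt\<close> is its unconditional law, which is also that of \<open>X\<close>;
  so the claim is that the first half carries asymptotically no information about \<open>X\<close>.

  For a single bounded Lipschitz test function \<open>\<phi>\<close>, the \<open>L\<^sub>1\<close> distance between the conditional
  expectations of \<open>\<phi>(X)\<close> and \<open>\<phi>(Xt)\<close> is at most twice the largest covariance of \<open>\<phi>(X)\<close> with an event of the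
  first half (\<open>kernel_diff_le_cov\<close>). Since \<open>X\<close> and \<open>X'\<close> are close in probability, \<open>X'\<close> may replace
  \<open>X\<close> in this covariance (\<open>event_cov_perturb\<close>). Because of the gap, the covariance is then at most
  \<open>2 \<beta>\<close> (\<open>event_cov_le_beta\<close>), or at most the \<open>\<tau>\<close>-coefficient of the remaining block times the
  Lipschitz constant of the estimator (\<open>event_cov_le_tau\<close>); the normalisation of the \<open>\<tau>\<close>-coefficient by
  the block length produces the factor \<open>n - i m n\<close>.

  The bounded Lipschitz metric is a supremum over all test functions at once. Tightness reduces it to
  finitely many: near a compact set that carries \<open>X'\<close> with high probability, and hence near which \<open>X\<close>
  lies with high probability, the test functions admit a finite uniform net
  (\<open>finite_BL_net_near_compact\<close>, \<open>d_BL_le_net\<close>). Markov's inequality turns the resulting bound in mean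
  into one in probability (\<open>d_BL_exceptional_event\<close>), and \<open>d_BL_vanishes_on_event\<close> carries out the limit.
  Finally, the finitely many models that are selected with probability tending to one are treated
  separately on the events \<open>{mhat n = m}\<close>.
\<close>

section \<open>Lipschitz constants and the bounded Lipschitz ball\<close>

text \<open>The infimum over Lipschitz constants is attained, because the defining inequalities are closed in
  the constant. Bounds on \<^const>\<open>lip_const\<close> thus become pointwise inequalities.\<close>

lemma lip_const_le_iff:
  assumes "0 \<le> C"
  shows "lip_const S T f \<le> ennreal C \<longleftrightarrow>
    (\<forall>x\<in>mspace S. \<forall>y\<in>mspace S. mdist T (f x) (f y) \<le> C * mdist S x y)"
    (is "_ \<longleftrightarrow> ?lip C")
proof
  assume "?lip C"
  with assms show "lip_const S T f \<le> ennreal C"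
    unfolding lip_const_def by (intro INF_lower) auto
next
  assume le: "lip_const S T f \<le> ennreal C"
  show "?lip C"
  proof (intro ballI)
    fix x y assume xy: "x \<in> mspace S" "y \<in> mspace S"
    have *: "mdist T (f x) (f y) \<le> D * mdist S x y" if "C < D" for D
    proof -
      have "lip_const S T f < ennreal D"
        using le that assms by (meson ennreal_lessI le_less_trans order_less_le_trans)
      then obtain C' where "0 \<le> C'" "?lip C'" "ennreal C' < ennreal D"
        unfolding lip_const_def INF_less_iff by blast
      moreover from this have "C' \<le> D"
        using assms that by (simp add: ennreal_less_iff)
      ultimately show ?thesis
        using xy by (meson mdist_nonneg mult_right_mono order_trans)
    qed
    have "((\<lambda>D. D * mdist S x y) \<longlongrightarrow> C * mdist S x y) (at_right C)"
      by (intro tendsto_intros)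
    moreover have "\<forall>\<^sub>F D in at_right C. mdist T (f x) (f y) \<le> D * mdist S x y"
      using * by (intro eventually_mono[OF eventually_at_right_less[of C]])
    ultimately show "mdist T (f x) (f y) \<le> C * mdist S x y"
      by (rule tendsto_lowerbound) simp
  qed
qed

definition BL_ball :: "'a metric \<Rightarrow> ('a \<Rightarrow> real) set" where
  "BL_ball T = {f. (\<forall>x\<in>mspace T. \<bar>f x\<bar> \<le> 1) \<and>
                   (\<forall>x\<in>mspace T. \<forall>y\<in>mspace T. \<bar>f x - f y\<bar> \<le> mdist T x y)}"

lemma d_BL_eq: "d_BL T P Q = (SUP f\<in>BL_ball T. (\<integral>x. f x \<partial>P) - (\<integral>x. f x \<partial>Q))"
proof -
  have "lip_const T euclidean_metric f \<le> 1 \<longleftrightarrow>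
      (\<forall>x\<in>mspace T. \<forall>y\<in>mspace T. \<bar>f x - f y\<bar> \<le> mdist T x y)" for f :: "'a \<Rightarrow> real"
    using lip_const_le_iff[of 1 T euclidean_metric f] by (simp add: dist_real_def)
  then show ?thesis
    unfolding d_BL_def BL_ball_def by simp
qed

lemma space_borel_alg [simp]: "space (borel_alg T) = mspace T"
  unfolding borel_alg_def
  by (rule space_measure_of) (auto dest!: openin_subset)

lemma openin_in_sets_borel_alg: "openin (mtopology_of T) U \<Longrightarrow> U \<in> sets (borel_alg T)"
  unfolding borel_alg_def
  by (subst sets_measure_of) (auto dest!: openin_subset)

lemma lipschitz_borel_measurable:
  fixes f :: "'a \<Rightarrow> real"
  assumes "\<And>x y. x \<in> mspace T \<Longrightarrow> y \<in> mspace T \<Longrightarrow> \<bar>f x - f y\<bar> \<le> C * mdist T x y"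
  shows "f \<in> borel_measurable (borel_alg T)"
proof (rule borel_measurableI)
  fix V :: "real set" assume "open V"
  have "Lipschitz_continuous_map T euclidean_metric f"
    using assms by (auto simp: Lipschitz_continuous_map_def dist_real_def)
  then have "continuous_map (mtopology_of T) euclidean f"
    using Lipschitz_continuous_imp_continuous_map by fastforce
  then have "openin (mtopology_of T) {x \<in> mspace T. f x \<in> V}"
    using \<open>open V\<close> openin_continuous_map_preimage by fastforce
  then show "f -` V \<inter> space (borel_alg T) \<in> sets (borel_alg T)"
    by (intro openin_in_sets_borel_alg) (simp add: vimage_def Int_def conj_commute)
qed

lemma BL_ball_measurable: "f \<in> BL_ball T \<Longrightarrow> f \<in> borel_measurable (borel_alg T)"
  by (rule lipschitz_borel_measurable[where C=1]) (auto simp: BL_ball_def)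

text \<open>Near a compact set, the bounded Lipschitz ball is totally bounded in the sup norm. This replaces
  the supremum over uncountably many test functions by a maximum over finitely many fixed ones, and it
  does so on a whole neighbourhood of the compact set, because only an approximation of the statistic
  of interest is known to be tight. The net consists of the lower Lipschitz envelopes
  \<open>x \<mapsto> max (-1) (max\<^sub>j (v\<^sub>j - d(x, j)))\<close> of finitely many prescribed values \<open>v\<^sub>j\<close> at the points \<open>j\<close> of a
  finite \<open>\<delta>\<close>-net; a function \<open>f\<close> is approximated by the envelope of its values rounded down to a
  grid.\<close>

lemma finite_BL_net_near_compact:
  assumes "compactin (mtopology_of T) C" "0 < \<delta>"
  obtains \<Phi> U where "finite \<Phi>" "\<Phi> \<subseteq> BL_ball T" "openin (mtopology_of T) U"
    "\<And>x y. x \<in> C \<Longrightarrow> y \<in> mspace T \<Longrightarrow> mdist T y x < \<delta> \<Longrightarrow> y \<in> U"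
    "\<And>f. f \<in> BL_ball T \<Longrightarrow> \<exists>\<phi>\<in>\<Phi>. \<forall>x\<in>U. \<bar>f x - \<phi> x\<bar> \<le> 5 * \<delta>"
proof -
  interpret Metric_space "mspace T" "mdist T" by simp
  have "mtotally_bounded C"
    using assms(1) unfolding mtopology_of_def by (rule compactin_imp_mtotally_bounded)
  then obtain J where J: "finite J" "J \<subseteq> C" "C \<subseteq> (\<Union>x\<in>J. mball x \<delta>)"
    using \<open>0 < \<delta>\<close> unfolding mtotally_bounded_def by meson
  have "C \<subseteq> mspace T"
    using compactin_subset_topspace[OF assms(1)] by simp
  then have JT: "J \<subseteq> mspace T" using J by blast
  (* Radius 2\<delta>: it contains every point closer than \<delta> to C, as each point of C is within \<delta> of J. *)
  define U where "U = (\<Union>x\<in>J. mball x (2 * \<delta>))"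
  obtain N :: nat where N: "1 / real (Suc N) < \<delta>"
    using \<open>0 < \<delta>\<close> nat_approx_posE by blast
  define n where "n = int (Suc N)"
  have n: "0 < n" "1 / real_of_int n < \<delta>" using N unfolding n_def by auto
  define grid where "grid = (\<lambda>k. real_of_int k / real_of_int n) ` {- n..n}"
  (* The value -1 keeps the maximum meaningful for empty J and bounds the envelope from below. *)
  define env where "env v x = Max (insert (-1) ((\<lambda>j. v j - mdist T x j) ` J))" for v x
  have env_le: "env v x \<le> c \<longleftrightarrow> -1 \<le> c \<and> (\<forall>j\<in>J. v j - mdist T x j \<le> c)" for v x c
    unfolding env_def using J(1) by (subst Max_le_iff) auto
  have le_env: "-1 \<le> env v x" "j \<in> J \<Longrightarrow> v j - mdist T x j \<le> env v x" for v x j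
    using env_le[of v x "env v x"] by auto
  define \<Phi> where "\<Phi> = env ` (J \<rightarrow>\<^sub>E grid)"
  have grid1: "r \<le> 1" if "r \<in> grid" for r
    using that n unfolding grid_def by (auto simp: divide_le_eq_1_pos)
  show thesis
  proof
    show "finite \<Phi>"
      unfolding \<Phi>_def grid_def using J by (intro finite_imageI finite_PiE) auto
    show "\<Phi> \<subseteq> BL_ball T"
    proof
      fix \<phi> assume "\<phi> \<in> \<Phi>"
      then obtain v where v: "\<phi> = env v" "v \<in> J \<rightarrow>\<^sub>E grid" unfolding \<Phi>_def by blast
      have "\<bar>env v x\<bar> \<le> 1" if "x \<in> mspace T" for x
      proof -
        have "env v x \<le> 1"
          unfolding env_le
        proof (intro conjI ballI)
          show "v j - mdist T x j \<le> 1" if "j \<in> J" for j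
            using grid1[OF PiE_mem[OF v(2) that]] mdist_nonneg[of T x j] by linarith
        qed simp
        with le_env(1)[of v x] show ?thesis by simp
      qed
      moreover have le: "env v x \<le> env v y + mdist T x y" if "x \<in> mspace T" "y \<in> mspace T" for x y
      proof -
        have "v j - mdist T x j \<le> env v y + mdist T x y" if "j \<in> J" for j
          using le_env(2)[OF that, of v y] triangle[of y x j] \<open>x \<in> _\<close> \<open>y \<in> _\<close> that JT
          by (auto simp: mdist_commute)
        moreover have "-1 \<le> env v y + mdist T x y"
          using le_env(1)[of v y] mdist_nonneg[of T x y] by linarith
        ultimately show ?thesis unfolding env_le by blast
      qed
      have "\<bar>env v x - env v y\<bar> \<le> mdist T x y" if "x \<in> mspace T" "y \<in> mspace T" for x y
        using le[of x y] le[of y x] that by (auto simp: mdist_commute abs_le_iff)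
      ultimately show "\<phi> \<in> BL_ball T"
        unfolding v(1) BL_ball_def by blast
    qed
    show "openin (mtopology_of T) U"
      unfolding U_def by (auto simp: mtopology_of_def)
    show "y \<in> U" if xy: "x \<in> C" "y \<in> mspace T" "mdist T y x < \<delta>" for x y
    proof -
      obtain j where "j \<in> J" "x \<in> mball j \<delta>" using J xy by blast
      then show ?thesis
        unfolding U_def using xy triangle[of j x y] by (auto simp: mdist_commute)
    qed
    show "\<exists>\<phi>\<in>\<Phi>. \<forall>x\<in>U. \<bar>f x - \<phi> x\<bar> \<le> 5 * \<delta>" if f: "f \<in> BL_ball T" for f
    proof -
      define v where "v = (\<lambda>j\<in>J. real_of_int \<lfloor>f j * real_of_int n\<rfloor> / real_of_int n)"
      have vj: "v j \<le> f j" "f j - \<delta> \<le> v j" "v j \<in> grid" if "j \<in> J" for j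
      proof -
        show "v j \<le> f j"
          using that n by (simp add: v_def pos_divide_le_eq)
        have "f j * n \<le> real_of_int \<lfloor>f j * real_of_int n\<rfloor> + 1" by linarith
        then have "f j \<le> v j + 1 / n"
          using that n by (simp add: v_def field_simps)
        with n show "f j - \<delta> \<le> v j" by linarith
        have "\<bar>f j\<bar> \<le> 1" using f that JT by (auto simp: BL_ball_def)
        then have "- n \<le> f j * n" "f j * n \<le> n"
          using n mult_right_mono[of "-1" "f j" "real_of_int n"] mult_right_mono[of "f j" 1 "real_of_int n"]
          by auto
        then have "\<lfloor>f j * real_of_int n\<rfloor> \<in> {- n..n}"
          by (simp add: le_floor_iff floor_le_iff)
        then show "v j \<in> grid"
          using that unfolding grid_def v_def by auto
      qed
      have "\<bar>f x - env v x\<bar> \<le> 5 * \<delta>" if "x \<in> U" for x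
      proof -
        obtain j where j: "j \<in> J" "mdist T x j < 2 * \<delta>" and x: "x \<in> mspace T"
          using \<open>x \<in> U\<close> unfolding U_def by (auto simp: mdist_commute)
        have lip: "\<bar>f x - f k\<bar> \<le> mdist T x k" if "k \<in> J" for k
          using f x that JT by (auto simp: BL_ball_def)
        have "env v x \<le> f x"
          unfolding env_le
        proof (intro conjI ballI)
          show "-1 \<le> f x" using f x by (auto simp: BL_ball_def abs_le_iff)
          show "v k - mdist T x k \<le> f x" if "k \<in> J" for k
            using lip[OF that] vj(1)[OF that] by linarith
        qed
        (* 2\<delta> each for the move from x to j in f and in the envelope, \<delta> for the rounding. *)
        moreover have "f x \<le> env v x + 5 * \<delta>"
          using le_env(2)[OF j(1), of v x] lip[OF j(1)] vj(2)[OF j(1)] j(2) by linarith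
        ultimately show ?thesis using \<open>0 < \<delta>\<close> by linarith
      qed
      moreover have "v \<in> J \<rightarrow>\<^sub>E grid"
        using vj(3) by (auto simp: v_def PiE_iff)
      ultimately show ?thesis unfolding \<Phi>_def by blast
    qed
  qed
qed

lemma prob_algebra_integral_bound:
  fixes f :: "'b \<Rightarrow> real"
  assumes "R \<in> space (prob_algebra S)" "f \<in> borel_measurable S" "\<And>x. x \<in> space S \<Longrightarrow> \<bar>f x\<bar> \<le> B"
  shows "integrable R f" "\<bar>\<integral>x. f x \<partial>R\<bar> \<le> B"
proof -
  from assms have sR: "sets R = sets S" and "prob_space R"
    by (auto simp: space_prob_algebra)
  interpret prob_space R by fact
  have [measurable]: "f \<in> borel_measurable R"
    using assms(2) measurable_cong_sets[OF sR refl] by blast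
  have b: "\<bar>f x\<bar> \<le> B" if "x \<in> space R" for x
    using assms(3) that sets_eq_imp_space_eq[OF sR] by simp
  show int: "integrable R f"
    by (rule integrable_const_bound[where B=B]) (auto intro!: AE_I2 b)
  have "\<bar>\<integral>x. f x \<partial>R\<bar> \<le> (\<integral>x. \<bar>f x\<bar> \<partial>R)"
    by (rule integral_abs_bound)
  also have "\<dots> \<le> (\<integral>x. B \<partial>R)"
    using b int by (intro integral_mono) auto
  finally show "\<bar>\<integral>x. f x \<partial>R\<bar> \<le> B" by (simp add: prob_space)
qed

text \<open>On \<open>U\<close> a test function is exchanged for an element of the net at the cost \<open>\<eta>\<close> under each measure;
  outside \<open>U\<close> two functions bounded by one differ by at most two.\<close>

lemma d_BL_le_net:
  assumes P: "P \<in> space (prob_algebra (borel_alg T))" and Q: "Q \<in> space (prob_algebra (borel_alg T))"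
    and \<Phi>: "finite \<Phi>" "\<Phi> \<subseteq> BL_ball T" and U: "U \<in> sets (borel_alg T)"
    and net: "\<And>f. f \<in> BL_ball T \<Longrightarrow> \<exists>\<phi>\<in>\<Phi>. \<forall>x\<in>U. \<bar>f x - \<phi> x\<bar> \<le> \<eta>" and \<eta>: "0 \<le> \<eta>"
  shows "\<bar>d_BL T P Q\<bar> \<le> (\<Sum>\<phi>\<in>\<Phi>. \<bar>(\<integral>x. \<phi> x \<partial>P) - (\<integral>x. \<phi> x \<partial>Q)\<bar>) + 2 * \<eta>
      + 2 * measure P (mspace T - U) + 2 * measure Q (mspace T - U)"
    (is "_ \<le> ?R")
proof -
  have int: "integrable R f"
    if "R \<in> space (prob_algebra (borel_alg T))" "f \<in> BL_ball T" for R f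
    using that BL_ball_measurable
    by (intro prob_algebra_integral_bound(1)[where B=1]) (auto simp: BL_ball_def)
  have close: "\<bar>(\<integral>x. f x \<partial>R) - (\<integral>x. \<phi> x \<partial>R)\<bar> \<le> \<eta> + 2 * measure R (mspace T - U)"
    if R: "R \<in> space (prob_algebra (borel_alg T))" and f: "f \<in> BL_ball T" and \<phi>: "\<phi> \<in> BL_ball T"
      and near: "\<forall>x\<in>U. \<bar>f x - \<phi> x\<bar> \<le> \<eta>" for R f \<phi>
  proof -
    from R have sR: "sets R = sets (borel_alg T)" and "prob_space R"
      by (auto simp: space_prob_algebra)
    interpret prob_space R by fact
    have sp: "space R = mspace T" using sets_eq_imp_space_eq[OF sR] by simp
    have [measurable]: "U \<in> sets R" using U sR by simp
    have c: "mspace T - U \<in> sets R" using sp[symmetric] by simp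
    note i = int[OF R f] int[OF R \<phi>]
    have "\<bar>(\<integral>x. f x \<partial>R) - (\<integral>x. \<phi> x \<partial>R)\<bar> = \<bar>\<integral>x. f x - \<phi> x \<partial>R\<bar>"
      using i by simp
    also have "\<dots> \<le> (\<integral>x. \<bar>f x - \<phi> x\<bar> \<partial>R)"
      by (rule integral_abs_bound)
    also have "\<dots> \<le> (\<integral>x. \<eta> + 2 * indicator (mspace T - U) x \<partial>R)"
    proof (rule integral_mono)
      show "integrable R (\<lambda>x. \<bar>f x - \<phi> x\<bar>)" using i by simp
      show "integrable R (\<lambda>x. \<eta> + 2 * indicator (mspace T - U) x)"
        using c by (auto simp: emeasure_eq_measure)
      fix x assume "x \<in> space R"
      then have x: "x \<in> mspace T" using sp by simp
      then have "\<bar>f x\<bar> \<le> 1" "\<bar>\<phi> x\<bar> \<le> 1" using f \<phi> by (auto simp: BL_ball_def)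
      then show "\<bar>f x - \<phi> x\<bar> \<le> \<eta> + 2 * indicator (mspace T - U) x"
        using near x \<eta> by (cases "x \<in> U") auto
    qed
    also have "\<dots> = \<eta> + 2 * measure R (mspace T - U)"
      using c sets.sets_into_space[OF c] by (simp add: prob_space emeasure_eq_measure Int_absorb2)
    finally show ?thesis .
  qed
  have ub: "(\<integral>x. f x \<partial>P) - (\<integral>x. f x \<partial>Q) \<le> ?R" if f: "f \<in> BL_ball T" for f
  proof -
    obtain \<phi> where \<phi>: "\<phi> \<in> \<Phi>" "\<forall>x\<in>U. \<bar>f x - \<phi> x\<bar> \<le> \<eta>" using net[OF f] by blast
    have "\<bar>(\<integral>x. \<phi> x \<partial>P) - (\<integral>x. \<phi> x \<partial>Q)\<bar> \<le> (\<Sum>\<phi>\<in>\<Phi>. \<bar>(\<integral>x. \<phi> x \<partial>P) - (\<integral>x. \<phi> x \<partial>Q)\<bar>)"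
      using \<phi>(1) \<Phi>(1) by (intro member_le_sum) auto
    moreover have "\<phi> \<in> BL_ball T" using \<phi> \<Phi> by blast
    ultimately show ?thesis
      using close[OF P f _ \<phi>(2)] close[OF Q f _ \<phi>(2)] by linarith
  qed
  have zero: "(\<lambda>_. 0) \<in> BL_ball T" by (auto simp: BL_ball_def)
  have bdd: "bdd_above ((\<lambda>f. (\<integral>x. f x \<partial>P) - (\<integral>x. f x \<partial>Q)) ` BL_ball T)"
    using ub by (auto intro!: bdd_aboveI)
  have "d_BL T P Q \<le> ?R"
    unfolding d_BL_eq using zero ub by (intro cSUP_least) auto
  moreover have "0 \<le> d_BL T P Q"
    unfolding d_BL_eq using cSUP_upper[OF zero bdd] by simp
  ultimately show ?thesis by simp
qed

section \<open>Regular conditional distributions\<close>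

text \<open>The definition of a regular conditional distribution disintegrates indicators; it says that
  restricting the underlying measure to \<open>A\<close> and mixing the kernel over it gives the law of \<open>X\<close> on \<open>A\<close>.
  Integrating against the two equal measures disintegrates bounded functions.\<close>

lemma is_rcd_set_integral:
  fixes f :: "'b \<Rightarrow> real"
  assumes M: "finite_measure M" and F: "subalgebra M F" and X: "X \<in> M \<rightarrow>\<^sub>M S"
    and K: "is_rcd M F S X K" and A: "A \<in> sets F"
    and f: "f \<in> borel_measurable S" and bound: "\<And>x. x \<in> space S \<Longrightarrow> \<bar>f x\<bar> \<le> B"
  shows "(\<integral>\<omega>. indicator A \<omega> * f (X \<omega>) \<partial>M) = (\<integral>\<omega>. indicator A \<omega> * (\<integral>x. f x \<partial>K \<omega>) \<partial>M)"
proof (cases "space M = {}")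
  case True
  then show ?thesis by (simp add: Bochner_Integration.integral_empty)
next
  case False
  interpret finite_measure M by fact
  have AM [measurable]: "A \<in> sets M" using A F by (auto simp: subalgebra_def)
  have KF: "K \<in> F \<rightarrow>\<^sub>M prob_algebra S" using K by (simp add: is_rcd_def)
  then have "K \<in> M \<rightarrow>\<^sub>M prob_algebra S"
    by (rule measurable_from_subalg[OF F])
  then have KM [measurable]: "K \<in> M \<rightarrow>\<^sub>M subprob_algebra S"
    by (rule measurable_prob_algebraD)
  note X [measurable] f [measurable]
  define D where "D = density M (indicator A)"
  have D_real: "D = density M (\<lambda>\<omega>. ennreal (indicator A \<omega>))"
    unfolding D_def by (simp add: ennreal_indicator)
  have [measurable_cong]: "sets D = sets M" unfolding D_def by simp
  have [simp]: "space D = space M" unfolding D_def by simp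
  have fin: "finite_measure D"
    unfolding D_def
    by (rule finite_measureI) (simp add: emeasure_density emeasure_eq_measure)
  have KD: "K \<in> D \<rightarrow>\<^sub>M subprob_algebra S" by measurable
  have XD: "X \<in> D \<rightarrow>\<^sub>M S" by measurable
  have eq: "distr D S X = D \<bind> K"
  proof (rule measure_eqI)
    show "sets (distr D S X) = sets (D \<bind> K)"
      by (subst sets_bind[where N=S]) (use False sets_kernel[OF KD] in auto)
    fix C assume "C \<in> sets (distr D S X)"
    then have C [measurable]: "C \<in> sets S" by simp
    have "emeasure (distr D S X) C = emeasure D (X -` C \<inter> space M)"
      using XD C by (simp add: emeasure_distr)
    also have "\<dots> = (\<integral>\<^sup>+\<omega>. indicator (A \<inter> X -` C \<inter> space M) \<omega> \<partial>M)"
    proof -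
      have "X -` C \<inter> space M \<in> sets M" by measurable
      then have "emeasure D (X -` C \<inter> space M)
          = (\<integral>\<^sup>+\<omega>. indicator A \<omega> * indicator (X -` C \<inter> space M) \<omega> \<partial>M)"
        unfolding D_def by (intro emeasure_density) auto
      also have "\<dots> = (\<integral>\<^sup>+\<omega>. indicator (A \<inter> X -` C \<inter> space M) \<omega> \<partial>M)"
        by (rule nn_integral_cong) (auto split: split_indicator)
      finally show ?thesis .
    qed
    also have "\<dots> = emeasure M (A \<inter> X -` C)"
    proof -
      have "A \<inter> X -` C \<inter> space M = A \<inter> X -` C" using sets.sets_into_space[OF AM] by auto
      moreover have "A \<inter> (X -` C \<inter> space M) \<in> sets M" by measurable
      ultimately show ?thesis by (simp add: Int_assoc)
    qed
    also have "\<dots> = (\<integral>\<^sup>+\<omega>\<in>A. emeasure (K \<omega>) C \<partial>M)"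
      using K A C by (simp add: is_rcd_def)
    also have "\<dots> = (\<integral>\<^sup>+\<omega>. emeasure (K \<omega>) C \<partial>D)"
      unfolding D_def
      by (subst nn_integral_density) (auto simp: mult.commute intro!: measurable_emeasure_kernel[OF KM])
    also have "\<dots> = emeasure (D \<bind> K) C"
      using False by (intro emeasure_bind[OF _ KD C, symmetric]) simp
    finally show "emeasure (distr D S X) C = emeasure (D \<bind> K) C" .
  qed
  have "(\<integral>\<omega>. indicator A \<omega> * f (X \<omega>) \<partial>M) = (\<integral>\<omega>. f (X \<omega>) \<partial>D)"
    unfolding D_real by (subst integral_real_density) auto
  also have "\<dots> = (\<integral>x. f x \<partial>(D \<bind> K))"
    unfolding eq[symmetric] using XD f by (simp add: integral_distr)
  also have "\<dots> = (\<integral>\<omega>. (\<integral>x. f x \<partial>K \<omega>) \<partial>D)"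
  proof (rule integral_bind[OF f bound KD fin, where B'=1])
    show "AE x in D. emeasure (K x) (space (K x)) \<le> ennreal 1"
      by (rule AE_I2) (use subprob_space.emeasure_space_le_1[OF subprob_space_kernel[OF KD]] in auto)
  qed
  also have "\<dots> = (\<integral>\<omega>. indicator A \<omega> * (\<integral>x. f x \<partial>K \<omega>) \<partial>M)"
    unfolding D_real
    by (subst integral_real_density) (auto intro!: measurable_compose[OF KM integral_measurable_subprob_algebra])
  finally show ?thesis .
qed

lemma is_rcd_cong:
  assumes "\<And>\<omega>. \<omega> \<in> space F \<Longrightarrow> X \<omega> = X' \<omega>"
  shows "is_rcd M F S X K \<longleftrightarrow> is_rcd M F S X' K"
proof -
  have "A \<inter> X -` B = A \<inter> X' -` B" if "A \<in> sets F" for A B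
    using sets.sets_into_space[OF that] assms by auto
  then show ?thesis unfolding is_rcd_def by simp
qed

section \<open>Covariances with events and the conditional bounded Lipschitz distance\<close>

text \<open>The covariance of \<open>\<xi>\<close> with the indicator of \<open>A\<close>. All dependence between the past and a statistic
  of the future enters through these numbers, with \<open>A\<close> ranging over past events.\<close>

definition event_cov :: "'w measure \<Rightarrow> 'w set \<Rightarrow> ('w \<Rightarrow> real) \<Rightarrow> real" where
  "event_cov M A \<xi> = (\<integral>\<omega>. indicator A \<omega> * \<xi> \<omega> \<partial>M) - measure M A * (\<integral>\<omega>. \<xi> \<omega> \<partial>M)"

text \<open>One model and one sample size: \<open>E\<close> is the event that the model is selected, \<open>X\<close> and \<open>Xt\<close> are the
  statistic of the original and of the copied second half, and \<open>K\<close>, \<open>Kt\<close> are their conditional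
  distributions given \<open>F\<close>, which are only meaningful on \<open>E\<close>.\<close>

locale selected_event = prob_space M for M :: "'w measure" +
  fixes F :: "'w measure" and E :: "'w set" and S :: "'b measure"
    and X Xt :: "'w \<Rightarrow> 'b" and K Kt :: "'w \<Rightarrow> 'b measure"
  assumes F: "subalgebra M F" and E: "E \<in> sets F"
    and X [measurable]: "X \<in> M \<rightarrow>\<^sub>M S" and Xt [measurable]: "Xt \<in> M \<rightarrow>\<^sub>M S"
    and K: "is_rcd (restrict_space M E) (restrict_space F E) S X K"
    and Kt: "is_rcd (restrict_space M E) (restrict_space F E) S Xt Kt"
    and law: "distr M S Xt = distr M S X"
begin

lemma E_sets [measurable]: "E \<in> sets M"
  using E F by (auto simp: subalgebra_def)

lemma E_Int [simp]: "E \<inter> space M = E" "space M \<inter> E = E"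
  using sets.sets_into_space[OF E_sets] by auto

lemma finite_restrict: "finite_measure (restrict_space M E)"
  by (rule finite_measureI) (simp add: emeasure_restrict_space space_restrict_space)

lemma subalgebra_restrict: "subalgebra (restrict_space M E) (restrict_space F E)"
  using F unfolding subalgebra_def by (auto simp: space_restrict_space sets_restrict_space)

lemma restricted_event: "A \<in> sets (restrict_space F E) \<Longrightarrow> A \<in> sets F \<and> A \<subseteq> E"
  using E sets.sets_into_space[OF E] by (auto simp: sets_restrict_space)

lemma kernel_space:
  assumes "\<omega> \<in> E"
  shows "K \<omega> \<in> space (prob_algebra S)" "Kt \<omega> \<in> space (prob_algebra S)"
proof -
  have "\<omega> \<in> space (restrict_space F E)"
    using assms sets.sets_into_space[OF E] by (auto simp: space_restrict_space)
  then show "K \<omega> \<in> space (prob_algebra S)" "Kt \<omega> \<in> space (prob_algebra S)"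
    using K Kt unfolding is_rcd_def by (auto dest: measurable_space)
qed

lemma kernel_integral_measurable:
  fixes f :: "'b \<Rightarrow> real"
  assumes f: "f \<in> borel_measurable S"
  shows "(\<lambda>\<omega>. \<integral>x. f x \<partial>K \<omega>) \<in> borel_measurable (restrict_space F E)"
    "(\<lambda>\<omega>. \<integral>x. f x \<partial>Kt \<omega>) \<in> borel_measurable (restrict_space F E)"
  using K Kt unfolding is_rcd_def
  by (auto intro!: measurable_compose[OF measurable_prob_algebraD integral_measurable_subprob_algebra] f)

lemma kernel_integral_integrable:
  fixes f :: "'b \<Rightarrow> real"
  assumes f: "f \<in> borel_measurable S" and bound: "\<And>x. x \<in> space S \<Longrightarrow> \<bar>f x\<bar> \<le> B"
  shows "integrable (restrict_space M E) (\<lambda>\<omega>. \<integral>x. f x \<partial>K \<omega>)"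
    "integrable (restrict_space M E) (\<lambda>\<omega>. \<integral>x. f x \<partial>Kt \<omega>)"
proof -
  interpret E: finite_measure "restrict_space M E" by (rule finite_restrict)
  note m = kernel_integral_measurable[OF f, THEN measurable_from_subalg[OF subalgebra_restrict]]
  have b: "\<bar>\<integral>x. f x \<partial>K \<omega>\<bar> \<le> B" "\<bar>\<integral>x. f x \<partial>Kt \<omega>\<bar> \<le> B" if "\<omega> \<in> space (restrict_space M E)" for \<omega>
    using that kernel_space[of \<omega>] prob_algebra_integral_bound(2)[OF _ f bound]
    by (auto simp: space_restrict_space)
  show "integrable (restrict_space M E) (\<lambda>\<omega>. \<integral>x. f x \<partial>K \<omega>)"
    "integrable (restrict_space M E) (\<lambda>\<omega>. \<integral>x. f x \<partial>Kt \<omega>)"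
    using b by (auto intro!: E.integrable_const_bound[where B=B] m AE_I2)
qed

text \<open>The \<open>L\<^sub>1\<close> distance of two conditional expectations is attained by testing with the sign of their
  difference. The sign is \<open>F\<close>-measurable, hence a difference of indicators of two \<open>F\<close>-events, and testing
  with such an indicator yields a covariance, because the copy contributes exactly the product of the
  probability and the common mean.\<close>

lemma kernel_diff_le_cov:
  fixes \<phi> :: "'b \<Rightarrow> real"
  assumes \<phi> [measurable]: "\<phi> \<in> borel_measurable S" and bound: "\<And>x. x \<in> space S \<Longrightarrow> \<bar>\<phi> x\<bar> \<le> 1"
    and cov: "\<And>A. A \<in> sets F \<Longrightarrow> \<bar>event_cov M A (\<lambda>\<omega>. \<phi> (X \<omega>))\<bar> \<le> c"
    and indep: "\<And>A. A \<in> sets F \<Longrightarrow> event_cov M A (\<lambda>\<omega>. \<phi> (Xt \<omega>)) = 0"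
  shows "(\<integral>\<omega>. \<bar>(\<integral>x. \<phi> x \<partial>K \<omega>) - (\<integral>x. \<phi> x \<partial>Kt \<omega>)\<bar> \<partial>restrict_space M E) \<le> 2 * c"
proof -
  let ?M = "restrict_space M E" and ?F = "restrict_space F E"
  define a where "a = (\<lambda>\<omega>. \<integral>x. \<phi> x \<partial>K \<omega>)"
  define b where "b = (\<lambda>\<omega>. \<integral>x. \<phi> x \<partial>Kt \<omega>)"
  have [measurable]: "a \<in> borel_measurable ?F" "b \<in> borel_measurable ?F"
    unfolding a_def b_def by (rule kernel_integral_measurable[OF \<phi>])+
  have [simp]: "integrable ?M a" "integrable ?M b"
    unfolding a_def b_def by (rule kernel_integral_integrable[OF \<phi> bound]; assumption)+
  define A where "A = {\<omega>\<in>space ?F. b \<omega> \<le> a \<omega>}"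
  define B where "B = {\<omega>\<in>space ?F. a \<omega> < b \<omega>}"
  have AB: "A \<in> sets ?F" "B \<in> sets ?F" unfolding A_def B_def by measurable
  have XE: "X \<in> ?M \<rightarrow>\<^sub>M S" "Xt \<in> ?M \<rightarrow>\<^sub>M S"
    using X Xt by (auto intro: measurable_restrict_space1)
  have diff: "(\<integral>\<omega>. indicator C \<omega> * a \<omega> \<partial>?M) - (\<integral>\<omega>. indicator C \<omega> * b \<omega> \<partial>?M)
      = event_cov M C (\<lambda>\<omega>. \<phi> (X \<omega>))" if C: "C \<in> sets ?F" for C
  proof -
    have C': "C \<in> sets F" "C \<subseteq> E" using restricted_event[OF C] by auto
    have res: "(\<integral>\<omega>. indicator C \<omega> * \<phi> (Z \<omega>) \<partial>?M) = (\<integral>\<omega>. indicator C \<omega> * \<phi> (Z \<omega>) \<partial>M)" for Z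
      using C'(2)
      by (subst integral_restrict_space) (auto intro!: Bochner_Integration.integral_cong split: split_indicator)
    have "(\<integral>\<omega>. \<phi> (Xt \<omega>) \<partial>M) = (\<integral>x. \<phi> x \<partial>distr M S Xt)"
      by (simp add: integral_distr)
    also have "\<dots> = (\<integral>\<omega>. \<phi> (X \<omega>) \<partial>M)"
      unfolding law by (simp add: integral_distr)
    finally have "(\<integral>\<omega>. indicator C \<omega> * \<phi> (Xt \<omega>) \<partial>M) = measure M C * (\<integral>\<omega>. \<phi> (X \<omega>) \<partial>M)"
      using indep[OF C'(1)] by (simp add: event_cov_def)
    moreover have "(\<integral>\<omega>. indicator C \<omega> * a \<omega> \<partial>?M) = (\<integral>\<omega>. indicator C \<omega> * \<phi> (X \<omega>) \<partial>?M)"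
      unfolding a_def
      using is_rcd_set_integral[OF finite_restrict subalgebra_restrict XE(1) K C \<phi> bound] by simp
    moreover have "(\<integral>\<omega>. indicator C \<omega> * b \<omega> \<partial>?M) = (\<integral>\<omega>. indicator C \<omega> * \<phi> (Xt \<omega>) \<partial>?M)"
      unfolding b_def
      using is_rcd_set_integral[OF finite_restrict subalgebra_restrict XE(2) Kt C \<phi> bound] by simp
    ultimately show ?thesis by (simp add: res event_cov_def)
  qed
  have AB': "A \<in> sets ?M" "B \<in> sets ?M"
    using AB subalgebra_restrict by (auto simp: subalgebra_def)
  have i: "integrable ?M (\<lambda>\<omega>. indicator C \<omega> * a \<omega>)" "integrable ?M (\<lambda>\<omega>. indicator C \<omega> * b \<omega>)"
    if "C \<in> sets ?M" for C
    using that integrable_mult_indicator[OF that, of a] integrable_mult_indicator[OF that, of b] by simp_all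
  have "(\<integral>\<omega>. \<bar>a \<omega> - b \<omega>\<bar> \<partial>?M) = (\<integral>\<omega>. (indicator A \<omega> * a \<omega> - indicator A \<omega> * b \<omega>)
      - (indicator B \<omega> * a \<omega> - indicator B \<omega> * b \<omega>) \<partial>?M)"
    using subalgebra_restrict
    by (intro Bochner_Integration.integral_cong) (auto simp: A_def B_def subalgebra_def split: split_indicator)
  also have "\<dots> = event_cov M A (\<lambda>\<omega>. \<phi> (X \<omega>)) - event_cov M B (\<lambda>\<omega>. \<phi> (X \<omega>))"
    using i AB' by (simp add: diff[OF AB(1), symmetric] diff[OF AB(2), symmetric])
  also have "\<dots> \<le> 2 * c"
    using cov[of A] cov[of B] restricted_event[OF AB(1)] restricted_event[OF AB(2)] by linarith
  finally show ?thesis unfolding a_def b_def .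
qed

lemma kernel_event_le:
  assumes C [measurable]: "C \<in> sets S"
  shows "(\<integral>\<omega>. measure (K \<omega>) C \<partial>restrict_space M E) \<le> measure M {\<omega>\<in>space M. X \<omega> \<in> C}"
    "(\<integral>\<omega>. measure (Kt \<omega>) C \<partial>restrict_space M E) \<le> measure M {\<omega>\<in>space M. X \<omega> \<in> C}"
proof -
  let ?M = "restrict_space M E" and ?F = "restrict_space F E"
  have *: "(\<integral>\<omega>. measure (L \<omega>) C \<partial>?M) \<le> measure M {\<omega>\<in>space M. Z \<omega> \<in> C}"
    if Z [measurable]: "Z \<in> M \<rightarrow>\<^sub>M S" and L: "is_rcd ?M ?F S Z L" for Z L
  proof -
    have ZE: "Z \<in> ?M \<rightarrow>\<^sub>M S" using Z by (rule measurable_restrict_space1)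
    have sp: "space ?F = space ?M" using subalgebra_restrict by (simp add: subalgebra_def)
    have "L \<omega> \<in> space (prob_algebra S)" if "\<omega> \<in> space ?F" for \<omega>
      using L that unfolding is_rcd_def by (auto dest: measurable_space)
    then have spL: "measure (L \<omega>) C = (\<integral>x. indicator C x \<partial>L \<omega>)" if "\<omega> \<in> space ?M" for \<omega>
      using that C sp by (auto simp: space_prob_algebra)
    have "(\<integral>\<omega>. measure (L \<omega>) C \<partial>?M) = (\<integral>\<omega>. indicator (space ?M) \<omega> * (\<integral>x. indicator C x \<partial>L \<omega>) \<partial>?M)"
      by (intro Bochner_Integration.integral_cong) (auto simp: spL)
    also have "\<dots> = (\<integral>\<omega>. indicator (space ?M) \<omega> * indicator C (Z \<omega>) \<partial>?M)"
      by (rule is_rcd_set_integral[OF finite_restrict subalgebra_restrict ZE L, where B=1, symmetric])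
        (auto simp: sp[symmetric])
    also have "\<dots> = (\<integral>\<omega>. indicator E \<omega> * indicator {\<omega>\<in>space M. Z \<omega> \<in> C} \<omega> \<partial>M)"
      by (subst integral_restrict_space)
         (auto intro!: Bochner_Integration.integral_cong split: split_indicator simp: space_restrict_space)
    also have "\<dots> \<le> (\<integral>\<omega>. indicator {\<omega>\<in>space M. Z \<omega> \<in> C} \<omega> \<partial>M)"
      by (intro integral_mono integrable_real_mult_indicator integrable_real_indicator)
         (auto simp: emeasure_eq_measure split: split_indicator)
    also have "\<dots> = measure M {\<omega>\<in>space M. Z \<omega> \<in> C}" by simp
    finally show ?thesis .
  qed
  show "(\<integral>\<omega>. measure (K \<omega>) C \<partial>?M) \<le> measure M {\<omega>\<in>space M. X \<omega> \<in> C}"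
    by (rule *[OF X K])
  have "measure M {\<omega>\<in>space M. Xt \<omega> \<in> C} = measure (distr M S Xt) C"
    by (simp add: measure_distr vimage_def Int_def conj_commute)
  also have "\<dots> = measure M {\<omega>\<in>space M. X \<omega> \<in> C}"
    unfolding law by (simp add: measure_distr vimage_def Int_def conj_commute)
  finally show "(\<integral>\<omega>. measure (Kt \<omega>) C \<partial>?M) \<le> measure M {\<omega>\<in>space M. X \<omega> \<in> C}"
    using *[OF Xt Kt] by simp
qed

text \<open>The right-hand side of the net bound for \<^const>\<open>d_BL\<close> has a small integral over \<open>E\<close>, so that
  Markov's inequality applies to it. The level set of \<^const>\<open>d_BL\<close>, a supremum over an uncountable set,
  is covered by the level set of that bound, which is an event.\<close>

lemma d_BL_exceptional_event:
  assumes S: "S = borel_alg T"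
    and \<Phi>: "finite \<Phi>" "\<Phi> \<subseteq> BL_ball T" and U: "U \<in> sets S"
    and net: "\<And>f. f \<in> BL_ball T \<Longrightarrow> \<exists>\<phi>\<in>\<Phi>. \<forall>x\<in>U. \<bar>f x - \<phi> x\<bar> \<le> \<eta>" and \<eta>: "0 \<le> \<eta>"
    and cov: "\<And>\<phi> A. \<phi> \<in> \<Phi> \<Longrightarrow> A \<in> sets F \<Longrightarrow> \<bar>event_cov M A (\<lambda>\<omega>. \<phi> (X \<omega>))\<bar> \<le> c"
    and indep: "\<And>\<phi> A. \<phi> \<in> \<Phi> \<Longrightarrow> A \<in> sets F \<Longrightarrow> event_cov M A (\<lambda>\<omega>. \<phi> (Xt \<omega>)) = 0"
    and \<epsilon>: "0 < \<epsilon>"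
  obtains N where "N \<in> sets M" "{\<omega>\<in>E. \<epsilon> < \<bar>d_BL T (K \<omega>) (Kt \<omega>)\<bar>} \<subseteq> N"
    "measure M N \<le> (2 * c * card \<Phi> + 2 * \<eta> + 4 * measure M {\<omega>\<in>space M. X \<omega> \<notin> U}) / \<epsilon>"
proof -
  let ?M = "restrict_space M E" and ?F = "restrict_space F E"
  interpret E: finite_measure ?M by (rule finite_restrict)
  define C where "C = mspace T - U"
  have C [measurable]: "C \<in> sets S"
    unfolding C_def S using sets.compl_sets[of U "borel_alg T"] U by (simp add: S)
  define R where "R \<omega> = (\<Sum>\<phi>\<in>\<Phi>. \<bar>(\<integral>x. \<phi> x \<partial>K \<omega>) - (\<integral>x. \<phi> x \<partial>Kt \<omega>)\<bar>) + 2 * \<eta>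
      + 2 * measure (K \<omega>) C + 2 * measure (Kt \<omega>) C" for \<omega>
  have \<Phi>m: "\<phi> \<in> borel_measurable S" if "\<phi> \<in> \<Phi>" for \<phi>
    using \<Phi>(2) that BL_ball_measurable S by blast
  have \<Phi>b: "\<bar>\<phi> x\<bar> \<le> 1" if "\<phi> \<in> \<Phi>" "x \<in> space S" for \<phi> x
    using \<Phi>(2) that S by (auto simp: BL_ball_def)
  have dR: "\<bar>d_BL T (K \<omega>) (Kt \<omega>)\<bar> \<le> R \<omega>" if "\<omega> \<in> E" for \<omega>
    unfolding R_def C_def
    using kernel_space[OF that] U unfolding S by (intro d_BL_le_net \<Phi> net \<eta>) auto
  have R0: "0 \<le> R \<omega>" for \<omega>
    unfolding R_def using \<eta> by (intro add_nonneg_nonneg sum_nonneg) auto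
  have iK: "integrable ?M (\<lambda>\<omega>. \<bar>(\<integral>x. \<phi> x \<partial>K \<omega>) - (\<integral>x. \<phi> x \<partial>Kt \<omega>)\<bar>)" if "\<phi> \<in> \<Phi>" for \<phi>
    using kernel_integral_integrable[OF \<Phi>m[OF that] \<Phi>b[OF that]] by auto
  have eqC: "measure (K \<omega>) C = (\<integral>x. indicator C x \<partial>K \<omega>)" "measure (Kt \<omega>) C = (\<integral>x. indicator C x \<partial>Kt \<omega>)"
    if "\<omega> \<in> space ?M" for \<omega>
    using that kernel_space[of \<omega>] C by (auto simp: space_prob_algebra space_restrict_space)
  have iC: "integrable ?M (\<lambda>\<omega>. measure (K \<omega>) C)" "integrable ?M (\<lambda>\<omega>. measure (Kt \<omega>) C)"
    using kernel_integral_integrable[of "indicator C" 1] C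
    by (simp_all only: eqC cong: Bochner_Integration.integrable_cong) auto
  have iR: "integrable ?M R"
    unfolding R_def using iK iC by (intro Bochner_Integration.integrable_add Bochner_Integration.integrable_sum) auto
  define N where "N = {\<omega>\<in>space ?M. \<epsilon> \<le> R \<omega>}"
  have [measurable]: "R \<in> borel_measurable ?M" using iR by auto
  have N: "N \<in> sets ?M" unfolding N_def by measurable
  have NE: "N \<in> sets M" "N \<subseteq> E"
    using N sets_restrict_space_iff[of E M N] by (auto simp: N_def space_restrict_space)
  have complU: "{\<omega>\<in>space M. X \<omega> \<notin> U} = {\<omega>\<in>space M. X \<omega> \<in> C}"
    using measurable_space[OF X] unfolding C_def S by auto
  have "(\<integral>\<omega>. R \<omega> \<partial>?M) = (\<Sum>\<phi>\<in>\<Phi>. \<integral>\<omega>. \<bar>(\<integral>x. \<phi> x \<partial>K \<omega>) - (\<integral>x. \<phi> x \<partial>Kt \<omega>)\<bar> \<partial>?M)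
      + 2 * \<eta> * measure ?M (space ?M) + 2 * (\<integral>\<omega>. measure (K \<omega>) C \<partial>?M) + 2 * (\<integral>\<omega>. measure (Kt \<omega>) C \<partial>?M)"
    unfolding R_def using iK iC
    by (simp add: Bochner_Integration.integral_sum Bochner_Integration.integrable_sum)
  also have "\<dots> \<le> (\<Sum>\<phi>\<in>\<Phi>. 2 * c) + 2 * \<eta> * 1
      + 2 * measure M {\<omega>\<in>space M. X \<omega> \<notin> U} + 2 * measure M {\<omega>\<in>space M. X \<omega> \<notin> U}"
  proof (intro add_mono sum_mono mult_left_mono)
    show "measure ?M (space ?M) \<le> 1" by (simp add: measure_restrict_space space_restrict_space)
    show "(\<integral>\<omega>. \<bar>(\<integral>x. \<phi> x \<partial>K \<omega>) - (\<integral>x. \<phi> x \<partial>Kt \<omega>)\<bar> \<partial>?M) \<le> 2 * c" if "\<phi> \<in> \<Phi>" for \<phi>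
      by (rule kernel_diff_le_cov[OF \<Phi>m[OF that] \<Phi>b[OF that] cov[OF that] indep[OF that]])
  qed (use kernel_event_le[OF C] \<eta> complU in auto)
  also have "\<dots> = 2 * c * card \<Phi> + 2 * \<eta> + 4 * measure M {\<omega>\<in>space M. X \<omega> \<notin> U}"
    by simp
  finally have R_le: "(\<integral>\<omega>. R \<omega> \<partial>?M) / \<epsilon>
      \<le> (2 * c * card \<Phi> + 2 * \<eta> + 4 * measure M {\<omega>\<in>space M. X \<omega> \<notin> U}) / \<epsilon>"
    using \<epsilon> by (intro divide_right_mono) auto
  have "measure M N = measure ?M N"
    using NE by (simp add: measure_restrict_space)
  also have "\<dots> \<le> (\<integral>\<omega>. R \<omega> \<partial>?M) / \<epsilon>"
    unfolding N_def by (rule integral_Markov_inequality_measure[OF iR sets.top])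
      (use R0 \<epsilon> in auto)
  also note R_le
  finally have "measure M N \<le> (2 * c * card \<Phi> + 2 * \<eta> + 4 * measure M {\<omega>\<in>space M. X \<omega> \<notin> U}) / \<epsilon>" .
  moreover have "{\<omega>\<in>E. \<epsilon> < \<bar>d_BL T (K \<omega>) (Kt \<omega>)\<bar>} \<subseteq> N"
    using dR unfolding N_def by (force simp: space_restrict_space)
  ultimately show thesis using that NE(1) by blast
qed

end

section \<open>Dependence coefficients bound covariances with events\<close>

context prob_space
begin

lemma event_cov_diff:
  assumes A [measurable]: "A \<in> events" and i [simp]: "integrable M \<xi>" "integrable M \<zeta>"
  shows "\<bar>event_cov M A \<xi> - event_cov M A \<zeta>\<bar> \<le> 2 * (\<integral>\<omega>. \<bar>\<xi> \<omega> - \<zeta> \<omega>\<bar> \<partial>M)"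
proof -
  let ?D = "\<integral>\<omega>. \<bar>\<xi> \<omega> - \<zeta> \<omega>\<bar> \<partial>M"
  have [simp]: "integrable M (\<lambda>\<omega>. indicator A \<omega> * \<xi> \<omega>)" "integrable M (\<lambda>\<omega>. indicator A \<omega> * \<zeta> \<omega>)"
    using integrable_mult_indicator[OF A i(1)] integrable_mult_indicator[OF A i(2)] by simp_all
  have "\<bar>\<integral>\<omega>. indicator A \<omega> * \<xi> \<omega> - indicator A \<omega> * \<zeta> \<omega> \<partial>M\<bar>
      \<le> (\<integral>\<omega>. \<bar>indicator A \<omega> * \<xi> \<omega> - indicator A \<omega> * \<zeta> \<omega>\<bar> \<partial>M)"
    by (rule integral_abs_bound)
  also have "\<dots> \<le> ?D"
    by (intro integral_mono) (auto split: split_indicator)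
  finally have 1: "\<bar>(\<integral>\<omega>. indicator A \<omega> * \<xi> \<omega> \<partial>M) - (\<integral>\<omega>. indicator A \<omega> * \<zeta> \<omega> \<partial>M)\<bar> \<le> ?D"
    by simp
  have "\<bar>(\<integral>\<omega>. \<xi> \<omega> \<partial>M) - (\<integral>\<omega>. \<zeta> \<omega> \<partial>M)\<bar> \<le> ?D"
    using integral_abs_bound[of M "\<lambda>\<omega>. \<xi> \<omega> - \<zeta> \<omega>"] by simp
  then have "prob A * \<bar>(\<integral>\<omega>. \<xi> \<omega> \<partial>M) - (\<integral>\<omega>. \<zeta> \<omega> \<partial>M)\<bar> \<le> 1 * ?D"
    by (intro mult_mono) auto
  then have 2: "\<bar>prob A * (\<integral>\<omega>. \<xi> \<omega> \<partial>M) - prob A * (\<integral>\<omega>. \<zeta> \<omega> \<partial>M)\<bar> \<le> ?D"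
    by (simp add: abs_mult flip: right_diff_distrib)
  show ?thesis unfolding event_cov_def using 1 2 by linarith
qed

lemma event_cov_const:
  assumes "A \<in> events" "\<And>\<omega>. \<omega> \<in> space M \<Longrightarrow> \<xi> \<omega> = c"
  shows "event_cov M A \<xi> = 0"
proof -
  have "(\<integral>\<omega>. indicator A \<omega> * \<xi> \<omega> \<partial>M) = (\<integral>\<omega>. indicator A \<omega> * c \<partial>M)"
    "(\<integral>\<omega>. \<xi> \<omega> \<partial>M) = (\<integral>\<omega>. c \<partial>M)"
    by (rule Bochner_Integration.integral_cong[OF refl], simp add: assms)+
  then show ?thesis using assms sets.sets_into_space[OF assms(1)]
    by (simp add: event_cov_def prob_space Int_absorb2)
qed

lemma sum_prob_partition:
  assumes "finite Q" "Q \<subseteq> events" "partition_on (space M) Q" "A \<in> events"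
  shows "(\<Sum>b\<in>Q. prob (A \<inter> b)) = prob A"
proof -
  have "prob (\<Union>b\<in>Q. A \<inter> b) = (\<Sum>b\<in>Q. prob (A \<inter> b))"
    using assms partition_onD2[OF assms(3)]
    by (intro finite_measure_finite_Union) (auto simp: disjoint_family_on_def disjoint_def)
  moreover have "(\<Union>b\<in>Q. A \<inter> b) = A"
    using partition_onD1[OF assms(3)] sets.sets_into_space[OF assms(4)] by auto
  ultimately show ?thesis by simp
qed

text \<open>The supremum in the mixing coefficient is bounded (by 2 before halving), so each pair of
  partitions gives a lower bound for it.\<close>

lemma beta_sum_le:
  assumes F: "subalgebra M F" and G: "subalgebra M G"
    and P: "finite P" "P \<subseteq> sets F" "partition_on (space M) P"
    and Q: "finite Q" "Q \<subseteq> sets G" "partition_on (space M) Q"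
  shows "(\<Sum>a\<in>P. \<Sum>b\<in>Q. \<bar>prob (a \<inter> b) - prob a * prob b\<bar>) \<le> 2 * beta_coeff M F G"
proof -
  let ?I = "{(A, B). finite A \<and> A \<subseteq> sets F \<and> partition_on (space M) A \<and>
                     finite B \<and> B \<subseteq> sets G \<and> partition_on (space M) B}"
  let ?s = "\<lambda>(A, B). \<Sum>a\<in>A. \<Sum>b\<in>B. \<bar>prob (a \<inter> b) - prob a * prob b\<bar>"
  have "bdd_above (?s ` ?I)"
  proof (rule bdd_aboveI2)
    fix z assume "z \<in> ?I"
    then obtain A B where z: "z = (A, B)"
      and A: "finite A" "A \<subseteq> events" "partition_on (space M) A"
      and B: "finite B" "B \<subseteq> events" "partition_on (space M) B"
      using F G unfolding subalgebra_def by auto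
    have tot: "(\<Sum>b\<in>C. prob b) = 1" if "finite C" "C \<subseteq> events" "partition_on (space M) C" for C
    proof -
      have "(\<Sum>b\<in>C. prob b) = (\<Sum>b\<in>C. prob (space M \<inter> b))"
        using that by (intro sum.cong) (auto simp: Int_absorb1 sets.sets_into_space)
      then show ?thesis using sum_prob_partition[OF that, of "space M"] by (simp add: prob_space)
    qed
    have "?s z \<le> (\<Sum>a\<in>A. \<Sum>b\<in>B. prob (a \<inter> b) + prob a * prob b)"
      unfolding z prod.case
      by (intro sum_mono order_trans[OF abs_triangle_ineq4]) auto
    also have "\<dots> = (\<Sum>a\<in>A. prob a + prob a)"
      using A B sum_prob_partition[OF B] tot[OF B]
      by (intro sum.cong) (auto simp: sum.distrib simp flip: sum_distrib_left)
    also have "\<dots> = 2" using tot[OF A] by (simp flip: sum_distrib_left)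
    finally show "?s z \<le> 2" .
  qed
  then have "?s (P, Q) \<le> (SUP z\<in>?I. ?s z)"
    using P Q by (intro cSUP_upper) auto
  then show ?thesis unfolding beta_coeff_def by simp
qed

text \<open>If \<open>\<xi>\<close> is a step function with values in \<open>[-1, 1]\<close>, its covariance with \<open>A\<close> is a signed and
  weighted part of the sum that the \<open>\<beta>\<close>-coefficient maximises, for the partition into \<open>A\<close> and its
  complement and the partition into level sets of \<open>\<xi>\<close>. The general case follows by rounding \<open>\<xi>\<close> down to
  the multiples of \<open>1 / (k + 1)\<close>.\<close>

lemma event_cov_le_beta:
  assumes F: "subalgebra M F" and G: "subalgebra M G" and A: "A \<in> sets F"
    and \<xi> [measurable]: "\<xi> \<in> borel_measurable G" and bound: "\<And>\<omega>. \<omega> \<in> space M \<Longrightarrow> \<bar>\<xi> \<omega>\<bar> \<le> 1"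
  shows "\<bar>event_cov M A \<xi>\<bar> \<le> 2 * beta_coeff M F G"
proof (cases "A = {}")
  case True
  have "beta_coeff M F G \<ge> 0"
  proof -
    have "partition_on (space M) {space M}"
      using not_empty by (auto simp: partition_on_def)
    moreover have "space M \<in> sets F" "space M \<in> sets G"
      using F G sets.top[of F] sets.top[of G] unfolding subalgebra_def by auto
    ultimately show ?thesis
      using beta_sum_le[OF F G, of "{space M}" "{space M}"] by (simp add: prob_space)
  qed
  then show ?thesis using True by (simp add: event_cov_def)
next
  case False
  have AM: "A \<in> events" using A F by (auto simp: subalgebra_def)
  have spG: "space G = space M" and spF: "space F = space M" and setsG: "sets G \<subseteq> events"
    using F G by (auto simp: subalgebra_def)
  have \<xi>M [measurable]: "\<xi> \<in> borel_measurable M" using measurable_from_subalg[OF G \<xi>] .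
  have i\<xi>: "integrable M \<xi>" by (rule integrable_const_bound[where B=1]) (auto intro: AE_I2 bound)
  have step: "\<bar>event_cov M A \<xi>\<bar> \<le> 2 * beta_coeff M F G + 2 / real (Suc k)" for k
  proof -
    define n where "n = int (Suc k)"
    have n: "0 < n" unfolding n_def by simp
    define B where "B j = {\<omega>\<in>space M. \<lfloor>\<xi> \<omega> * real_of_int n\<rfloor> = j}" for j
    (* Empty level sets are dropped: a partition has no empty members, and B is injective on J. *)
    define J where "J = {j\<in>{- n..n}. B j \<noteq> {}}"
    define r where "r \<omega> = real_of_int \<lfloor>\<xi> \<omega> * real_of_int n\<rfloor> / real_of_int n" for \<omega>
    have finJ: "finite J" unfolding J_def by (rule finite_subset[of _ "{- n..n}"]) auto
    have BG: "B j \<in> sets G" for j unfolding B_def spG[symmetric] by measurable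
    then have BM [measurable]: "B j \<in> events" for j using setsG by auto
    have range: "\<lfloor>\<xi> \<omega> * real_of_int n\<rfloor> \<in> J" if "\<omega> \<in> space M" for \<omega>
    proof -
      have "- n \<le> \<xi> \<omega> * n" "\<xi> \<omega> * n \<le> n"
        using bound[OF that] n mult_right_mono[of "-1" "\<xi> \<omega>" "real_of_int n"]
          mult_right_mono[of "\<xi> \<omega>" 1 "real_of_int n"] by auto
      then show ?thesis
        using that unfolding J_def B_def by (auto simp: le_floor_iff floor_le_iff)
    qed
    have r_eq: "r \<omega> = (\<Sum>j\<in>J. real_of_int j / real_of_int n * indicator (B j) \<omega>)" if "\<omega> \<in> space M" for \<omega>
    proof -
      have "(\<Sum>j\<in>J. real_of_int j / real_of_int n * indicator (B j) \<omega>)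
          = (\<Sum>j\<in>J. if j = \<lfloor>\<xi> \<omega> * real_of_int n\<rfloor> then real_of_int j / real_of_int n else 0)"
        using that by (intro sum.cong) (auto simp: B_def)
      then show ?thesis using range[OF that] finJ by (simp add: r_def)
    qed
    have [measurable]: "r \<in> borel_measurable M" unfolding r_def by measurable
    have near: "\<bar>\<xi> \<omega> - r \<omega>\<bar> \<le> 1 / real (Suc k)" for \<omega>
    proof -
      have "real_of_int \<lfloor>\<xi> \<omega> * real_of_int n\<rfloor> \<le> \<xi> \<omega> * real_of_int n"
        "\<xi> \<omega> * real_of_int n \<le> real_of_int \<lfloor>\<xi> \<omega> * real_of_int n\<rfloor> + 1" by linarith+
      then have "r \<omega> \<le> \<xi> \<omega>" "\<xi> \<omega> \<le> r \<omega> + 1 / real_of_int n"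
        using n unfolding r_def by (auto simp: field_simps)
      then show ?thesis unfolding n_def by simp
    qed
    have ir: "integrable M r"
    proof (rule integrable_const_bound[where B=2])
      show "AE \<omega> in M. norm (r \<omega>) \<le> 2"
      proof (rule AE_I2)
        fix \<omega> assume "\<omega> \<in> space M"
        moreover have "1 / real (Suc k) \<le> 1" by simp
        ultimately show "norm (r \<omega>) \<le> 2" using near[of \<omega>] bound[of \<omega>] unfolding real_norm_def by linarith
      qed
    qed measurable
    have "\<bar>event_cov M A \<xi> - event_cov M A r\<bar> \<le> 2 * (\<integral>\<omega>. \<bar>\<xi> \<omega> - r \<omega>\<bar> \<partial>M)"
      by (rule event_cov_diff[OF AM i\<xi> ir])
    also have "(\<integral>\<omega>. \<bar>\<xi> \<omega> - r \<omega>\<bar> \<partial>M) \<le> (\<integral>\<omega>. 1 / real (Suc k) \<partial>M)"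
      using near i\<xi> ir by (intro integral_mono) auto
    finally have 1: "\<bar>event_cov M A \<xi> - event_cov M A r\<bar> \<le> 2 / real (Suc k)"
      by (simp add: prob_space)
    have "event_cov M A r = (\<Sum>j\<in>J. real_of_int j / real_of_int n * (prob (A \<inter> B j) - prob A * prob (B j)))"
    proof -
      have "(\<integral>\<omega>. indicator A \<omega> * r \<omega> \<partial>M) = (\<integral>\<omega>. (\<Sum>j\<in>J. real_of_int j / real_of_int n * indicator (A \<inter> B j) \<omega>) \<partial>M)"
        by (intro Bochner_Integration.integral_cong) (auto simp: r_eq sum_distrib_left indicator_inter_arith mult_ac)
      also have "\<dots> = (\<Sum>j\<in>J. real_of_int j / real_of_int n * prob (A \<inter> B j))"
        using AM by (subst Bochner_Integration.integral_sum) (auto simp: emeasure_eq_measure)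
      finally have a: "(\<integral>\<omega>. indicator A \<omega> * r \<omega> \<partial>M) = (\<Sum>j\<in>J. real_of_int j / real_of_int n * prob (A \<inter> B j))" .
      have "(\<integral>\<omega>. r \<omega> \<partial>M) = (\<integral>\<omega>. (\<Sum>j\<in>J. real_of_int j / real_of_int n * indicator (B j) \<omega>) \<partial>M)"
        by (intro Bochner_Integration.integral_cong) (auto simp: r_eq)
      also have "\<dots> = (\<Sum>j\<in>J. real_of_int j / real_of_int n * prob (B j))"
        by (subst Bochner_Integration.integral_sum) (auto simp: emeasure_eq_measure)
      finally show ?thesis
        unfolding event_cov_def a by (simp add: sum_distrib_left sum_subtractf right_diff_distrib mult_ac)
    qed
    also have "\<bar>\<dots>\<bar> \<le> (\<Sum>j\<in>J. \<bar>prob (A \<inter> B j) - prob A * prob (B j)\<bar>)"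
    proof (rule order_trans[OF sum_abs], rule sum_mono)
      fix j assume "j \<in> J"
      then have "\<bar>real_of_int j / real_of_int n\<bar> \<le> 1"
        using n unfolding J_def by (auto simp: abs_le_iff divide_le_eq le_divide_eq)
      then have "\<bar>real_of_int j / real_of_int n\<bar> * \<bar>prob (A \<inter> B j) - prob A * prob (B j)\<bar>
          \<le> 1 * \<bar>prob (A \<inter> B j) - prob A * prob (B j)\<bar>"
        by (rule mult_right_mono) simp
      then show "\<bar>real_of_int j / real_of_int n * (prob (A \<inter> B j) - prob A * prob (B j))\<bar>
          \<le> \<bar>prob (A \<inter> B j) - prob A * prob (B j)\<bar>" by (simp add: abs_mult)
    qed
    also have "\<dots> = (\<Sum>b\<in>B ` J. \<bar>prob (A \<inter> b) - prob A * prob b\<bar>)"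
    proof -
      have "inj_on B J" unfolding inj_on_def J_def B_def by blast
      then show ?thesis by (simp add: sum.reindex)
    qed
    also have "\<dots> \<le> (\<Sum>a\<in>{A, space M - A} - {{}}. \<Sum>b\<in>B ` J. \<bar>prob (a \<inter> b) - prob a * prob b\<bar>)"
      using False by (intro member_le_sum) (auto intro: sum_nonneg)
    also have "\<dots> \<le> 2 * beta_coeff M F G"
    proof (rule beta_sum_le[OF F G])
      have "space M - A \<in> sets F" using sets.compl_sets[OF A] spF by simp
      then show "{A, space M - A} - {{}} \<subseteq> sets F" using A by auto
      show "partition_on (space M) ({A, space M - A} - {{}})"
        using sets.sets_into_space[OF AM] by (auto simp: partition_on_def disjoint_def)
      show "B ` J \<subseteq> sets G" using BG by auto
      show "partition_on (space M) (B ` J)"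
      proof (rule partition_onI)
        show "\<Union>(B ` J) = space M" using range by (fastforce simp: B_def)
        show "disjnt p q" if "p \<in> B ` J" "q \<in> B ` J" "p \<noteq> q" for p q
          using that by (auto simp: B_def disjnt_def)
        show "{} \<notin> B ` J" by (auto simp: J_def)
      qed
    qed (use finJ in auto)
    finally show ?thesis using 1 by linarith
  qed
  show ?thesis
  proof (rule field_le_epsilon)
    fix e :: real assume "0 < e"
    then obtain k where "1 / real (Suc k) < e / 2" using nat_approx_posE[of "e / 2"] by auto
    then show "\<bar>event_cov M A \<xi>\<bar> \<le> 2 * beta_coeff M F G + e" using step[of k] by simp
  qed
qed

text \<open>Conditioning on \<open>F\<close> turns the covariance into the mean over \<open>A\<close> of the difference between the
  conditional and the unconditional expectation of \<open>\<psi>(X)\<close>. As \<open>\<psi> / C\<close> is 1-Lipschitz, that difference is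
  at most \<open>C\<close> times the Wasserstein distance, for every version of the conditional distribution.
  A constant \<open>\<psi>\<close>, the case \<open>C = 0\<close>, has covariance zero even when the coefficient is infinite.\<close>

lemma event_cov_le_tau:
  fixes \<psi> :: "'b \<Rightarrow> real"
  assumes F: "subalgebra M F" and A: "A \<in> sets F" and X [measurable]: "X \<in> M \<rightarrow>\<^sub>M S"
    and spS: "space S = mspace T" and \<psi> [measurable]: "\<psi> \<in> borel_measurable S"
    and bound: "\<And>x. x \<in> space S \<Longrightarrow> \<bar>\<psi> x\<bar> \<le> 1" and C: "0 \<le> C"
    and lip: "\<And>x y. x \<in> mspace T \<Longrightarrow> y \<in> mspace T \<Longrightarrow> \<bar>\<psi> x - \<psi> y\<bar> \<le> C * mdist T x y"
  shows "ennreal \<bar>event_cov M A (\<lambda>\<omega>. \<psi> (X \<omega>))\<bar> \<le> ennreal C * tau_coeff M F T S X"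
proof (cases "C = 0")
  case True
  obtain \<omega>0 where \<omega>0: "\<omega>0 \<in> space M" using not_empty by auto
  have AM: "A \<in> events" using A F by (auto simp: subalgebra_def)
  have "\<psi> (X \<omega>) = \<psi> (X \<omega>0)" if "\<omega> \<in> space M" for \<omega>
    using lip[of "X \<omega>" "X \<omega>0"] True that \<omega>0 measurable_space[OF X] spS by auto
  then have "event_cov M A (\<lambda>\<omega>. \<psi> (X \<omega>)) = 0" by (rule event_cov_const[OF AM])
  then show ?thesis by simp
next
  case False
  with C have C: "0 < C" by simp
  have AM [measurable]: "A \<in> events" using A F by (auto simp: subalgebra_def)
  define P where "P = distr M S X"
  let ?e = "event_cov M A (\<lambda>\<omega>. \<psi> (X \<omega>))"
  have P: "(\<integral>x. \<psi> x \<partial>P) = (\<integral>\<omega>. \<psi> (X \<omega>) \<partial>M)"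
    unfolding P_def by (simp add: integral_distr)
  have "ennreal (\<bar>?e\<bar> / C) \<le> (\<integral>\<^sup>+\<omega>. d_W T (K \<omega>) P \<partial>M)" if K: "is_rcd M F S X K" for K
  proof -
    define a where "a \<omega> = (\<integral>x. \<psi> x \<partial>K \<omega>)" for \<omega>
    have KM: "K \<in> M \<rightarrow>\<^sub>M prob_algebra S"
      using K measurable_from_subalg[OF F] unfolding is_rcd_def by blast
    have [measurable]: "a \<in> borel_measurable M"
      unfolding a_def
      by (rule measurable_compose[OF measurable_prob_algebraD[OF KM] integral_measurable_subprob_algebra[OF \<psi>]])
    have "\<bar>a \<omega>\<bar> \<le> 1" if "\<omega> \<in> space M" for \<omega>
      unfolding a_def using prob_algebra_integral_bound(2)[OF measurable_space[OF KM that] \<psi> bound] by simp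
    then have ia [simp]: "integrable M a"
      by (intro integrable_const_bound[where B=1]) (auto intro!: AE_I2)
    have [simp]: "integrable M (\<lambda>\<omega>. indicator A \<omega> * a \<omega>)"
      using integrable_mult_indicator[OF AM ia] by simp
    have "?e = (\<integral>\<omega>. indicator A \<omega> * a \<omega> \<partial>M) - prob A * (\<integral>x. \<psi> x \<partial>P)"
      unfolding event_cov_def P a_def
      using is_rcd_set_integral[OF finite_measure_axioms F X K A \<psi> bound] by simp
    also have "\<dots> = (\<integral>\<omega>. indicator A \<omega> * a \<omega> - indicator A \<omega> * (\<integral>x. \<psi> x \<partial>P) \<partial>M)"
      using AM by (subst Bochner_Integration.integral_diff) (auto simp: emeasure_eq_measure)
    finally have "\<bar>?e\<bar> \<le> (\<integral>\<omega>. \<bar>indicator A \<omega> * a \<omega> - indicator A \<omega> * (\<integral>x. \<psi> x \<partial>P)\<bar> \<partial>M)"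
      using integral_abs_bound by simp
    also have "\<dots> \<le> (\<integral>\<omega>. \<bar>a \<omega> - (\<integral>x. \<psi> x \<partial>P)\<bar> \<partial>M)"
      by (intro integral_mono) (auto split: split_indicator simp: emeasure_eq_measure)
    finally have "\<bar>?e\<bar> / C \<le> (\<integral>\<omega>. \<bar>a \<omega> - (\<integral>x. \<psi> x \<partial>P)\<bar> / C \<partial>M)"
      using C by (simp add: divide_right_mono)
    then have "ennreal (\<bar>?e\<bar> / C) \<le> ennreal (\<integral>\<omega>. \<bar>a \<omega> - (\<integral>x. \<psi> x \<partial>P)\<bar> / C \<partial>M)"
      by (rule ennreal_leI)
    also have "\<dots> = (\<integral>\<^sup>+\<omega>. ennreal (\<bar>a \<omega> - (\<integral>x. \<psi> x \<partial>P)\<bar> / C) \<partial>M)"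
      using C by (intro nn_integral_eq_integral[symmetric]) auto
    also have "\<dots> \<le> (\<integral>\<^sup>+\<omega>. d_W T (K \<omega>) P \<partial>M)"
    (* The integral of the possibly non-measurable Wasserstein distance enters through monotonicity. *)
    proof (rule nn_integral_mono)
      fix \<omega> assume "\<omega> \<in> space M"
      have lip': "lip_const T euclidean_metric (\<lambda>x. s * \<psi> x / C) \<le> 1" if "s = 1 \<or> s = -1" for s
        using lip_const_le_iff[of 1 T euclidean_metric "\<lambda>x. s * \<psi> x / C"] lip that C
        by (auto simp: dist_real_def divide_le_eq abs_minus_commute mult.commute simp flip: diff_divide_distrib)
      have "ennreal ((\<integral>x. s * \<psi> x / C \<partial>K \<omega>) - (\<integral>x. s * \<psi> x / C \<partial>P)) \<le> d_W T (K \<omega>) P"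
        if "s = 1 \<or> s = -1" for s
        unfolding d_W_def by (rule SUP_upper) (use lip'[OF that] in simp)
      from this[of 1] this[of "-1"]
      have "ennreal ((a \<omega> - (\<integral>x. \<psi> x \<partial>P)) / C) \<le> d_W T (K \<omega>) P"
        "ennreal (- (a \<omega> - (\<integral>x. \<psi> x \<partial>P)) / C) \<le> d_W T (K \<omega>) P"
        by (simp_all add: a_def diff_divide_distrib)
      then show "ennreal (\<bar>a \<omega> - (\<integral>x. \<psi> x \<partial>P)\<bar> / C) \<le> d_W T (K \<omega>) P"
        unfolding abs_real_def by (simp split: if_splits)
    qed
    finally show ?thesis .
  qed
  then have "ennreal (\<bar>?e\<bar> / C) \<le> tau_coeff M F T S X"
    unfolding tau_coeff_def P_def by (intro INF_greatest) simp
  then have "ennreal C * ennreal (\<bar>?e\<bar> / C) \<le> ennreal C * tau_coeff M F T S X"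
    by (rule mult_left_mono) simp
  then show ?thesis using C by (simp flip: ennreal_mult)
qed

end

section \<open>Sample spaces with the supremum distance\<close>

lemma space_vecs_alg: "space (vecs_alg p I) = (\<Pi>\<^sub>E j\<in>I. \<Pi>\<^sub>E c\<in>{1..p}. UNIV)"
  by (simp add: vecs_alg_def vec_alg_def space_PiM)

lemma vecs_alg_component_measurable:
  assumes "j \<in> I" "c \<in> {1..p}"
  shows "(\<lambda>x. x j c) \<in> borel_measurable (vecs_alg p I)"
proof -
  have "(\<lambda>x. x j) \<in> vecs_alg p I \<rightarrow>\<^sub>M vec_alg p"
    unfolding vecs_alg_def using assms(1) by (rule measurable_component_singleton)
  moreover have "(\<lambda>y. y c) \<in> borel_measurable (vec_alg p)"
    unfolding vec_alg_def using assms(2) by (rule measurable_component_singleton)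
  ultimately show ?thesis by (rule measurable_compose)
qed

lemma mdist_vecs_metric_le_iff:
  assumes I: "finite I" and x: "x \<in> space (vecs_alg p I)" and y: "y \<in> space (vecs_alg p I)" and a: "0 \<le> a"
  shows "mdist (vecs_metric p I) x y \<le> a \<longleftrightarrow> (\<forall>j\<in>I. \<forall>c\<in>{1..p}. \<bar>x j c - y j c\<bar> \<le> a)"
proof -
  let ?V = "funspace {1..p} (euclidean_metric :: real metric)"
  have V: "mspace ?V = (\<Pi>\<^sub>E c\<in>{1..p}. UNIV)"
    by (subst mspace_funspace_finite) auto
  have xV: "x j \<in> mspace ?V" "y j \<in> mspace ?V" if "j \<in> I" for j
    using x y that unfolding V space_vecs_alg by auto
  have inner: "mdist ?V u v \<le> a \<longleftrightarrow> (\<forall>c\<in>{1..p}. \<bar>u c - v c\<bar> \<le> a)"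
    if "u \<in> mspace ?V" "v \<in> mspace ?V" for u v
  proof (cases "p = 0")
    case True
    then have "u = v" using that unfolding V by auto
    then have "mdist ?V u v = 0" using that by (subst mdist_zero) auto
    then show ?thesis using a True by (simp del: mspace_funspace mdist_funspace)
  next
    case False
    then show ?thesis
      using funspace_mdist_le[OF that, of a] by (auto simp: dist_real_def simp del: mspace_funspace mdist_funspace)
  qed
  have xI: "x \<in> mspace (funspace I ?V)" "y \<in> mspace (funspace I ?V)"
    using x y mspace_vecs_metric[OF I, of p] by (simp_all add: vecs_metric_def del: mspace_funspace)
  show ?thesis
  proof (cases "I = {}")
    case True
    then have "x = y" using x y unfolding space_vecs_alg by auto
    then have "mdist (funspace I ?V) x y = 0" using xI by (subst mdist_zero) auto
    then show ?thesis using a True by (simp add: vecs_metric_def del: mspace_funspace mdist_funspace)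
  next
    case False
    then show ?thesis
      using funspace_mdist_le[OF xI False, of a] inner xV
      by (simp add: vecs_metric_def del: mspace_funspace mdist_funspace)
  qed
qed

text \<open>Rounding all coordinates down to multiples of \<open>1 / (k + 1)\<close> moves a point by at most \<open>1 / (k + 1)\<close>
  in the sup distance. A Lipschitz function is thus the pointwise limit of its compositions with these
  roundings, and each composition is measurable because the rounding takes countably many values.\<close>

lemma lipschitz_vecs_alg_measurable:
  fixes \<psi> :: "(nat \<Rightarrow> nat \<Rightarrow> real) \<Rightarrow> real"
  assumes I: "finite I"
    and lip: "\<And>x y. x \<in> space (vecs_alg p I) \<Longrightarrow> y \<in> space (vecs_alg p I) \<Longrightarrow>
      \<bar>\<psi> x - \<psi> y\<bar> \<le> C * mdist (vecs_metric p I) x y"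
  shows "\<psi> \<in> borel_measurable (vecs_alg p I)"
proof -
  let ?V = "vecs_alg p I"
  define D :: "(nat \<Rightarrow> nat \<Rightarrow> int) set" where "D = (\<Pi>\<^sub>E j\<in>I. \<Pi>\<^sub>E c\<in>{1..p}. UNIV)"
  define lower where "lower k x = (\<lambda>j\<in>I. \<lambda>c\<in>{1..p}. \<lfloor>x j c * real (Suc k)\<rfloor>)"
    for k :: nat and x :: "nat \<Rightarrow> nat \<Rightarrow> real"
  define pt where "pt k z = (\<lambda>j\<in>I. \<lambda>c\<in>{1..p}. real_of_int (z j c) / real (Suc k))"
    for k :: nat and z :: "nat \<Rightarrow> nat \<Rightarrow> int"
  have D: "countable D"
    unfolding D_def using I by (intro countable_PiE) auto
  have lower: "lower k \<in> ?V \<rightarrow>\<^sub>M count_space D" for k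
  proof (subst measurable_count_space_eq_countable[OF D], intro conjI ballI)
    show "lower k \<in> space ?V \<rightarrow> D" by (auto simp: lower_def D_def PiE_iff)
    fix z assume z: "z \<in> D"
    have "lower k -` {z} \<inter> space ?V = {x\<in>space ?V. \<forall>j\<in>I. \<forall>c\<in>{1..p}. \<lfloor>x j c * real (Suc k)\<rfloor> = z j c}"
    proof (intro set_eqI iffI)
      fix x assume "x \<in> lower k -` {z} \<inter> space ?V"
      then have "z = lower k x" "x \<in> space ?V" by auto
      then show "x \<in> {x\<in>space ?V. \<forall>j\<in>I. \<forall>c\<in>{1..p}. \<lfloor>x j c * real (Suc k)\<rfloor> = z j c}"
        by (auto simp: lower_def)
    next
      fix x assume x: "x \<in> {x\<in>space ?V. \<forall>j\<in>I. \<forall>c\<in>{1..p}. \<lfloor>x j c * real (Suc k)\<rfloor> = z j c}"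
      have "lower k x = z"
      proof (rule PiE_ext[of _ I "\<lambda>_. \<Pi>\<^sub>E c\<in>{1..p}. UNIV"])
        show "z \<in> (\<Pi>\<^sub>E j\<in>I. \<Pi>\<^sub>E c\<in>{1..p}. UNIV)" using z unfolding D_def .
        fix j assume j: "j \<in> I"
        then have "z j \<in> (\<Pi>\<^sub>E c\<in>{1..p}. UNIV)" using z unfolding D_def by auto
        then show "lower k x j = z j"
          using x j unfolding lower_def
          by (intro PiE_ext[of _ "{1..p}" "\<lambda>_. UNIV"]) (auto simp: PiE_iff)
      qed (auto simp: lower_def PiE_iff)
      then show "x \<in> lower k -` {z} \<inter> space ?V" using x by auto
    qed
    also have "\<dots> \<in> sets ?V"
    proof (intro sets.sets_Collect_finite_All I finite_atLeastAtMost)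
      fix j c assume jc: "j \<in> I" "c \<in> {1..p}"
      note [measurable] = vecs_alg_component_measurable[OF jc]
      show "{x\<in>space ?V. \<lfloor>x j c * real (Suc k)\<rfloor> = z j c} \<in> sets ?V" by measurable
    qed
    finally show "lower k -` {z} \<inter> space ?V \<in> sets ?V" .
  qed
  show ?thesis
  proof (rule borel_measurable_LIMSEQ_real)
    show "(\<lambda>x. \<psi> (pt k (lower k x))) \<in> borel_measurable ?V" for k
      by (rule measurable_compose_countable'[OF _ lower D]) simp
    fix x assume x: "x \<in> space ?V"
    have pt: "pt k (lower k x) \<in> space ?V" for k
      by (auto simp: space_vecs_alg pt_def PiE_iff)
    have near: "mdist (vecs_metric p I) (pt k (lower k x)) x \<le> 1 / real (Suc k)" for k
    proof (subst mdist_vecs_metric_le_iff[OF I pt x], simp, intro ballI)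
      fix j c assume jc: "j \<in> I" "c \<in> {1..p}"
      have "real_of_int \<lfloor>x j c * real (Suc k)\<rfloor> \<le> x j c * real (Suc k)"
        "x j c * real (Suc k) \<le> real_of_int \<lfloor>x j c * real (Suc k)\<rfloor> + 1" by linarith+
      then have "real_of_int \<lfloor>x j c * real (Suc k)\<rfloor> / real (Suc k) \<le> x j c"
        "x j c \<le> real_of_int \<lfloor>x j c * real (Suc k)\<rfloor> / real (Suc k) + 1 / real (Suc k)"
        by (auto simp: field_simps simp del: of_nat_Suc)
      then show "\<bar>pt k (lower k x) j c - x j c\<bar> \<le> 1 / real (Suc k)"
        using jc by (simp add: pt_def lower_def del: of_nat_Suc)
    qed
    have bound: "\<bar>\<psi> (pt k (lower k x)) - \<psi> x\<bar> \<le> \<bar>C\<bar> * (1 / real (Suc k))" for k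
    proof -
      have "\<bar>\<psi> (pt k (lower k x)) - \<psi> x\<bar> \<le> C * mdist (vecs_metric p I) (pt k (lower k x)) x"
        by (rule lip[OF pt x])
      also have "\<dots> \<le> \<bar>C\<bar> * (1 / real (Suc k))"
        by (rule mult_mono) (use near in auto)
      finally show ?thesis .
    qed
    have lim: "(\<lambda>k. \<bar>C\<bar> * (1 / real (Suc k))) \<longlonglongrightarrow> 0"
      using tendsto_mult[OF tendsto_const LIMSEQ_inverse_real_of_nat, of "\<bar>C\<bar>"]
      by (simp only: inverse_eq_divide mult_zero_right)
    have "(\<lambda>k. \<psi> (pt k (lower k x)) - \<psi> x) \<longlonglongrightarrow> 0"
      by (rule Lim_null_comparison[OF _ lim]) (simp only: real_norm_def bound eventually_True)
    then show "(\<lambda>k. \<psi> (pt k (lower k x))) \<longlonglongrightarrow> \<psi> x"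
      by (simp add: LIM_zero_iff)
  qed
qed

text \<open>An estimator is applied to coordinates numbered from 1, while the dependence coefficients refer to
  the original positions. The passage between the two numberings is measurable and does not increase
  distances, so Lipschitz constants carry over.\<close>

definition reindex :: "nat \<Rightarrow> nat \<Rightarrow> (nat \<Rightarrow> nat \<Rightarrow> real) \<Rightarrow> nat \<Rightarrow> nat \<Rightarrow> real" where
  "reindex a k x = (\<lambda>j\<in>{1..k}. x (a + j))"

lemma sample_eq_reindex:
  assumes "{a+1..a+k} \<subseteq> I"
  shows "sample Y a k \<omega> = reindex a k (block Y I \<omega>)"
proof -
  have "a + j \<in> I" if "j \<in> {1..k}" for j using assms that by auto
  then show ?thesis by (auto simp: sample_def reindex_def block_def)
qed

lemma reindex_measurable:
  assumes "{a+1..a+k} \<subseteq> I"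
  shows "reindex a k \<in> vecs_alg p I \<rightarrow>\<^sub>M vecs_alg p {1..k}"
  unfolding reindex_def vecs_alg_def
proof (rule measurable_restrict)
  fix j assume "j \<in> {1..k}"
  then have "a + j \<in> I" using assms by auto
  then show "(\<lambda>x. x (a + j)) \<in> PiM I (\<lambda>_. vec_alg p) \<rightarrow>\<^sub>M vec_alg p"
    by (rule measurable_component_singleton)
qed

lemma mdist_reindex_le:
  assumes I: "finite I" "{a+1..a+k} \<subseteq> I" and x: "x \<in> space (vecs_alg p I)" and y: "y \<in> space (vecs_alg p I)"
  shows "mdist (vecs_metric p {1..k}) (reindex a k x) (reindex a k y) \<le> mdist (vecs_metric p I) x y"
proof -
  have "reindex a k \<in> space (vecs_alg p I) \<rightarrow> space (vecs_alg p {1..k})"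
    using reindex_measurable[OF I(2), of p] by (auto dest: measurable_space)
  then have r: "reindex a k x \<in> space (vecs_alg p {1..k})" "reindex a k y \<in> space (vecs_alg p {1..k})"
    using x y by auto
  have "\<bar>x j c - y j c\<bar> \<le> mdist (vecs_metric p I) x y" if "j \<in> I" "c \<in> {1..p}" for j c
    using iffD1[OF mdist_vecs_metric_le_iff[OF I(1) x y mdist_nonneg[of "vecs_metric p I" x y]] order_refl] that by blast
  moreover have "a + j \<in> I" if "j \<in> {1..k}" for j
    using that by (intro subsetD[OF I(2)]) simp
  ultimately have "\<forall>j\<in>{1..k}. \<forall>c\<in>{1..p}. \<bar>reindex a k x j c - reindex a k y j c\<bar> \<le> mdist (vecs_metric p I) x y"
    by (simp add: reindex_def)
  then show ?thesis
    by (rule iffD2[OF mdist_vecs_metric_le_iff[OF finite_atLeastAtMost r mdist_nonneg[of "vecs_metric p I" x y]]])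
qed

lemma block_measurable:
  assumes "\<And>j. j \<in> I \<Longrightarrow> Y j \<in> M \<rightarrow>\<^sub>M vec_alg p"
  shows "block Y I \<in> M \<rightarrow>\<^sub>M vecs_alg p I"
  unfolding block_def vecs_alg_def using assms by (rule measurable_restrict)

lemma sigma_gen_measurable:
  assumes "\<And>j. j \<in> I \<Longrightarrow> Y j \<in> M \<rightarrow>\<^sub>M vec_alg p"
  shows "block Y I \<in> sigma_gen M p Y I \<rightarrow>\<^sub>M vecs_alg p I" "subalgebra M (sigma_gen M p Y I)"
    "sets (sigma_gen M p Y I) = {block Y I -` B \<inter> space M |B. B \<in> sets (vecs_alg p I)}"
proof -
  have b: "block Y I \<in> M \<rightarrow>\<^sub>M vecs_alg p I" by (rule block_measurable) fact
  then have sp: "block Y I \<in> space M \<rightarrow> space (vecs_alg p I)" by (auto dest: measurable_space)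
  show "block Y I \<in> sigma_gen M p Y I \<rightarrow>\<^sub>M vecs_alg p I"
    unfolding sigma_gen_def by (rule measurable_vimage_algebra1[OF sp])
  show *: "sets (sigma_gen M p Y I) = {block Y I -` B \<inter> space M |B. B \<in> sets (vecs_alg p I)}"
    unfolding sigma_gen_def by (rule sets_vimage_algebra2[OF sp])
  show "subalgebra M (sigma_gen M p Y I)"
    unfolding subalgebra_def * using b by (auto simp: sigma_gen_def)
qed

section \<open>Asymptotic independence on a selection event\<close>

context prob_space
begin

text \<open>A bounded Lipschitz function changes by at most \<open>\<delta>\<close> off \<open>N\<close> and by at most two on \<open>N\<close>; the mean
  change counts twice, once in each of the two terms of the covariance.\<close>

lemma event_cov_perturb:
  assumes A: "A \<in> events" and \<phi>: "\<phi> \<in> BL_ball T"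
    and X: "\<And>\<omega>. \<omega> \<in> space M \<Longrightarrow> X \<omega> \<in> mspace T" and X': "\<And>\<omega>. \<omega> \<in> space M \<Longrightarrow> X' \<omega> \<in> mspace T"
    and m [measurable]: "(\<lambda>\<omega>. \<phi> (X \<omega>)) \<in> borel_measurable M" "(\<lambda>\<omega>. \<phi> (X' \<omega>)) \<in> borel_measurable M"
    and N [measurable]: "N \<in> events" and far: "{\<omega>\<in>space M. \<delta> < \<bar>mdist T (X \<omega>) (X' \<omega>)\<bar>} \<subseteq> N" and \<delta>: "0 \<le> \<delta>"
  shows "\<bar>event_cov M A (\<lambda>\<omega>. \<phi> (X \<omega>))\<bar> \<le> \<bar>event_cov M A (\<lambda>\<omega>. \<phi> (X' \<omega>))\<bar> + 2 * \<delta> + 4 * prob N"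
proof -
  have b: "\<bar>\<phi> x\<bar> \<le> 1" if "x \<in> mspace T" for x using \<phi> that by (auto simp: BL_ball_def)
  have i: "integrable M (\<lambda>\<omega>. \<phi> (X \<omega>))" "integrable M (\<lambda>\<omega>. \<phi> (X' \<omega>))"
    using b X X' by (auto intro!: integrable_const_bound[where B=1] AE_I2)
  have "(\<integral>\<omega>. \<bar>\<phi> (X \<omega>) - \<phi> (X' \<omega>)\<bar> \<partial>M) \<le> (\<integral>\<omega>. \<delta> + 2 * indicator N \<omega> \<partial>M)"
  proof (rule integral_mono)
    show "integrable M (\<lambda>\<omega>. \<bar>\<phi> (X \<omega>) - \<phi> (X' \<omega>)\<bar>)" using i by simp
    show "integrable M (\<lambda>\<omega>. \<delta> + 2 * indicator N \<omega>)" by (simp add: emeasure_eq_measure)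
    fix \<omega> assume \<omega>: "\<omega> \<in> space M"
    show "\<bar>\<phi> (X \<omega>) - \<phi> (X' \<omega>)\<bar> \<le> \<delta> + 2 * indicator N \<omega>"
    proof (cases "\<omega> \<in> N")
      case True
      then show ?thesis using b[OF X[OF \<omega>]] b[OF X'[OF \<omega>]] \<delta> by simp
    next
      case False
      then have "mdist T (X \<omega>) (X' \<omega>) \<le> \<delta>" using far \<omega> by force
      moreover have "\<bar>\<phi> (X \<omega>) - \<phi> (X' \<omega>)\<bar> \<le> mdist T (X \<omega>) (X' \<omega>)"
        using \<phi> X[OF \<omega>] X'[OF \<omega>] by (auto simp: BL_ball_def)
      ultimately show ?thesis using False by simp
    qed
  qed
  also have "\<dots> = \<delta> + 2 * prob N" by (simp add: prob_space emeasure_eq_measure)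
  finally show ?thesis using event_cov_diff[OF A i] by linarith
qed

lemma prob_outside_nbhd:
  assumes U: "{\<omega>\<in>space M. X \<omega> \<notin> U} \<in> events" and N: "N \<in> events"
    and near: "\<And>\<omega>. \<omega> \<in> space M \<Longrightarrow> \<omega> \<notin> N \<Longrightarrow> X' \<omega> \<in> C \<Longrightarrow> X \<omega> \<in> U"
    and tight: "1 - \<epsilon> \<le> prob {\<omega>\<in>space M. X' \<omega> \<in> C}" and \<epsilon>: "\<epsilon> < 1"
  shows "prob {\<omega>\<in>space M. X \<omega> \<notin> U} \<le> \<epsilon> + prob N"
proof -
  let ?C = "{\<omega>\<in>space M. X' \<omega> \<in> C}"
  \<comment> \<open>A set outside the \<sigma>-algebra has measure zero, which the lower bound excludes.\<close>
  have C: "?C \<in> events"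
    using tight \<epsilon> measure_notin_sets[of ?C M] by (cases "?C \<in> events") auto
  have "prob {\<omega>\<in>space M. X \<omega> \<notin> U} \<le> prob ((space M - ?C) \<union> N)"
    using near C N by (intro finite_measure_mono) auto
  also have "\<dots> \<le> prob (space M - ?C) + prob N"
    using C N by (intro measure_Un_le) auto
  finally show ?thesis using tight prob_compl[OF C] by simp
qed

lemma event_cov_independent:
  assumes ind: "indep_var S1 Z1 S2 Z2" and f: "f \<in> borel_measurable S1"
    and bound: "\<And>x. x \<in> space S1 \<Longrightarrow> \<bar>f x\<bar> \<le> 1"
    and B: "B \<in> sets S2"
  shows "event_cov M (Z2 -` B \<inter> space M) (\<lambda>\<omega>. f (Z1 \<omega>)) = 0"
proof -
  have Z [measurable]: "Z1 \<in> M \<rightarrow>\<^sub>M S1" "Z2 \<in> M \<rightarrow>\<^sub>M S2"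
    using indep_var_rv1[OF ind] indep_var_rv2[OF ind] by auto
  have [measurable]: "f \<in> borel_measurable S1" "B \<in> sets S2" by fact+
  have "indep_var borel (f \<circ> Z1) borel (indicator B \<circ> Z2 :: _ \<Rightarrow> real)"
    by (rule indep_var_compose[OF ind]) measurable
  then have ind': "indep_var borel (\<lambda>\<omega>. f (Z1 \<omega>)) borel (\<lambda>\<omega>. indicator B (Z2 \<omega>) :: real)"
    by (simp add: comp_def)
  have i: "integrable M (\<lambda>\<omega>. f (Z1 \<omega>))" "integrable M (\<lambda>\<omega>. indicator B (Z2 \<omega>) :: real)"
    using bound measurable_space[OF Z(1)]
    by (auto intro!: integrable_const_bound[where B=1] AE_I2)
  have ind_eq: "indicator (Z2 -` B \<inter> space M) \<omega> = (indicator B (Z2 \<omega>) :: real)" if "\<omega> \<in> space M" for \<omega>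
    using that by (auto split: split_indicator)
  have "(\<integral>\<omega>. indicator (Z2 -` B \<inter> space M) \<omega> * f (Z1 \<omega>) \<partial>M) = (\<integral>\<omega>. f (Z1 \<omega>) * indicator B (Z2 \<omega>) \<partial>M)"
    by (intro Bochner_Integration.integral_cong) (auto simp: ind_eq)
  also have "\<dots> = (\<integral>\<omega>. f (Z1 \<omega>) \<partial>M) * (\<integral>\<omega>. indicator B (Z2 \<omega>) \<partial>M)"
    by (rule indep_var_lebesgue_integral[OF ind' i])
  also have "(\<integral>\<omega>. (indicator B (Z2 \<omega>) :: real) \<partial>M) = (\<integral>\<omega>. indicator (Z2 -` B \<inter> space M) \<omega> \<partial>M)"
    by (intro Bochner_Integration.integral_cong) (auto simp: ind_eq)
  finally show ?thesis by (simp add: event_cov_def)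
qed

end

text \<open>Here \<open>X'\<close> is the statistic after a gap: it is tight and weakly dependent on the past, and close to
  the statistic \<open>X\<close> in probability. Tightness of \<open>X'\<close> fixes a finite net of test functions that also
  serves \<open>X\<close>; for each of these finitely many functions the covariance with past events passes from \<open>X'\<close>
  to \<open>X\<close>.\<close>

lemma d_BL_vanishes_on_event:
  fixes X Xt X' :: "nat \<Rightarrow> 'w \<Rightarrow> 'b"
  assumes sel: "\<And>n. n \<ge> 2 \<Longrightarrow> selected_event (M n) (F n) (E n) (borel_alg T) (X n) (Xt n) (K n) (Kt n)"
    and X': "\<And>n \<omega>. n \<ge> 2 \<Longrightarrow> \<omega> \<in> space (M n) \<Longrightarrow> X' n \<omega> \<in> mspace T"
    and tight: "tight_family {2..} M T X'"
    and close: "conv_in_prob_0 M (\<lambda>n \<omega>. mdist T (X n \<omega>) (X' n \<omega>))"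
    and dep: "\<And>\<phi> c. \<phi> \<in> BL_ball T \<Longrightarrow> 0 < c \<Longrightarrow>
      \<forall>\<^sub>F n in sequentially. (\<lambda>\<omega>. \<phi> (X' n \<omega>)) \<in> borel_measurable (M n) \<and>
        (\<forall>A\<in>sets (F n). \<bar>event_cov (M n) A (\<lambda>\<omega>. \<phi> (X' n \<omega>))\<bar> \<le> c)"
    and indep: "\<And>n \<phi> A. n \<ge> 2 \<Longrightarrow> \<phi> \<in> BL_ball T \<Longrightarrow> A \<in> sets (F n) \<Longrightarrow>
      event_cov (M n) A (\<lambda>\<omega>. \<phi> (Xt n \<omega>)) = 0"
    and \<epsilon>: "0 < \<epsilon>" and b: "0 < b"
  shows "\<forall>\<^sub>F n in sequentially. \<exists>N\<in>sets (M n).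
    {\<omega>\<in>E n. \<epsilon> < \<bar>d_BL T (K n \<omega>) (Kt n \<omega>)\<bar>} \<subseteq> N \<and> measure (M n) N \<le> b"
proof -
  (* Budget: Markov's inequality divides by \<epsilon>, so the integral must stay below a. The four terms
     (covariances, net, tightness, closeness) get a/4, a/4, a/8 and a/8. *)
  define a where "a = b * \<epsilon>"
  have a: "0 < a" using \<epsilon> b by (simp add: a_def)
  have close': "\<exists>N. (\<forall>n. N n \<in> sets (M n) \<and> {\<omega>\<in>space (M n). d < \<bar>mdist T (X n \<omega>) (X' n \<omega>)\<bar>} \<subseteq> N n) \<and>
      (\<lambda>n. measure (M n) (N n)) \<longlonglongrightarrow> 0" if "0 < d" for d
    using close that unfolding conv_in_prob_0_def by blast
  define \<epsilon>' where "\<epsilon>' = min (a / 32) (1 / 2)"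
  have \<epsilon>': "0 < \<epsilon>'" "\<epsilon>' < 1" "\<epsilon>' \<le> a / 32" using a by (auto simp: \<epsilon>'_def)
  obtain C where C: "compactin (mtopology_of T) C"
    "\<And>n. n \<ge> 2 \<Longrightarrow> 1 - \<epsilon>' \<le> measure (M n) {\<omega>\<in>space (M n). X' n \<omega> \<in> C}"
    using tight \<epsilon>'(1) unfolding tight_family_def by (metis atLeast_iff)
  define \<delta> where "\<delta> = a / 40"
  have \<delta>: "0 < \<delta>" using a by (simp add: \<delta>_def)
  obtain \<Phi> U where \<Phi>: "finite \<Phi>" "\<Phi> \<subseteq> BL_ball T" and U: "openin (mtopology_of T) U"
    and nbhd: "\<And>x y. x \<in> C \<Longrightarrow> y \<in> mspace T \<Longrightarrow> mdist T y x < \<delta> \<Longrightarrow> y \<in> U"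
    and net: "\<And>f. f \<in> BL_ball T \<Longrightarrow> \<exists>\<phi>\<in>\<Phi>. \<forall>x\<in>U. \<bar>f x - \<phi> x\<bar> \<le> 5 * \<delta>"
    using finite_BL_net_near_compact[OF C(1) \<delta>] by metis
  define c where "c = a / (8 * (real (card \<Phi>) + 1))"
  have c: "0 < c" using a by (simp add: c_def)
  have c_le: "2 * c * card \<Phi> \<le> a / 4"
    using a by (simp add: c_def field_simps)
  obtain N where N: "\<And>n. N n \<in> sets (M n)"
    "\<And>n. {\<omega>\<in>space (M n). \<delta> / 2 < \<bar>mdist T (X n \<omega>) (X' n \<omega>)\<bar>} \<subseteq> N n"
    "(\<lambda>n. measure (M n) (N n)) \<longlonglongrightarrow> 0"
    using close'[of "\<delta> / 2"] \<delta> by auto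
  (* The bound c on the covariance of X splits into c/2 for X', 2 c/8 for closeness and 4 c/16 for the
     exceptional event. *)
  obtain N' where N': "\<And>n. N' n \<in> sets (M n)"
    "\<And>n. {\<omega>\<in>space (M n). c / 8 < \<bar>mdist T (X n \<omega>) (X' n \<omega>)\<bar>} \<subseteq> N' n"
    "(\<lambda>n. measure (M n) (N' n)) \<longlonglongrightarrow> 0"
    using close'[of "c / 8"] c by auto
  have "\<forall>\<^sub>F n in sequentially. measure (M n) (N n) < a / 32"
    using N(3) a by (intro order_tendstoD(2)) auto
  moreover have "\<forall>\<^sub>F n in sequentially. measure (M n) (N' n) < c / 16"
    using N'(3) c by (intro order_tendstoD(2)) auto
  moreover have "\<forall>\<^sub>F n in sequentially. \<forall>\<phi>\<in>\<Phi>. (\<lambda>\<omega>. \<phi> (X' n \<omega>)) \<in> borel_measurable (M n) \<and>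
        (\<forall>A\<in>sets (F n). \<bar>event_cov (M n) A (\<lambda>\<omega>. \<phi> (X' n \<omega>))\<bar> \<le> c / 2)"
    using \<Phi> c by (intro eventually_ball_finite ballI dep) auto
  moreover have "\<forall>\<^sub>F n in sequentially. 2 \<le> n" by (rule eventually_ge_at_top)
  ultimately show ?thesis
  proof eventually_elim
    case (elim n)
    interpret selected_event "M n" "F n" "E n" "borel_alg T" "X n" "Xt n" "K n" "Kt n"
      by (rule sel) (rule elim)
    have XT: "X n \<omega> \<in> mspace T" if "\<omega> \<in> space (M n)" for \<omega>
      using measurable_space[OF X that] by simp
    have U': "U \<in> sets (borel_alg T)" by (rule openin_in_sets_borel_alg[OF U])
    have XU: "{\<omega>\<in>space (M n). X n \<omega> \<notin> U} \<in> sets (M n)" using X U' by measurable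
    have cov: "\<bar>event_cov (M n) A (\<lambda>\<omega>. \<phi> (X n \<omega>))\<bar> \<le> c" if "\<phi> \<in> \<Phi>" "A \<in> sets (F n)" for \<phi> A
    proof -
      have \<phi>: "\<phi> \<in> BL_ball T" using that \<Phi> by blast
      have "A \<in> sets (M n)" using that F by (auto simp: subalgebra_def)
      then have "\<bar>event_cov (M n) A (\<lambda>\<omega>. \<phi> (X n \<omega>))\<bar>
          \<le> \<bar>event_cov (M n) A (\<lambda>\<omega>. \<phi> (X' n \<omega>))\<bar> + 2 * (c / 8) + 4 * measure (M n) (N' n)"
        using c elim(3) that
        by (intro event_cov_perturb[OF _ \<phi>] XT X'[OF elim(4)] N'
            measurable_compose[OF X BL_ball_measurable[OF \<phi>]]) auto
      then show ?thesis using elim(2,3) that by fastforce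
    qed
    have outside: "measure (M n) {\<omega>\<in>space (M n). X n \<omega> \<notin> U} \<le> \<epsilon>' + measure (M n) (N n)"
    proof (rule prob_outside_nbhd[OF XU N(1) _ C(2)[OF elim(4)] \<epsilon>'(2)])
      fix \<omega> assume \<omega>: "\<omega> \<in> space (M n)" "\<omega> \<notin> N n" "X' n \<omega> \<in> C"
      then have "mdist T (X n \<omega>) (X' n \<omega>) \<le> \<delta> / 2" using N(2)[of n] by force
      then show "X n \<omega> \<in> U" using nbhd[OF \<omega>(3) XT[OF \<omega>(1)]] \<delta> by simp
    qed
    obtain N0 where N0: "N0 \<in> sets (M n)" "{\<omega>\<in>E n. \<epsilon> < \<bar>d_BL T (K n \<omega>) (Kt n \<omega>)\<bar>} \<subseteq> N0"
      "measure (M n) N0 \<le> (2 * c * card \<Phi> + 2 * (5 * \<delta>) + 4 * measure (M n) {\<omega>\<in>space (M n). X n \<omega> \<notin> U}) / \<epsilon>"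
    proof (rule d_BL_exceptional_event[OF refl \<Phi> U' net _ cov _ \<epsilon>])
      show "event_cov (M n) A (\<lambda>\<omega>. \<phi> (Xt n \<omega>)) = 0" if "\<phi> \<in> \<Phi>" "A \<in> sets (F n)" for \<phi> A
        using indep[OF elim(4)] that \<Phi> by blast
    qed (use \<delta> in auto)
    have "2 * c * card \<Phi> + 2 * (5 * \<delta>) + 4 * measure (M n) {\<omega>\<in>space (M n). X n \<omega> \<notin> U} \<le> a"
      using c_le outside \<epsilon>'(3) elim(1) a unfolding \<delta>_def by simp
    then have "(2 * c * card \<Phi> + 2 * (5 * \<delta>) + 4 * measure (M n) {\<omega>\<in>space (M n). X n \<omega> \<notin> U}) / \<epsilon> \<le> b"
      using \<epsilon> by (simp add: a_def pos_divide_le_eq)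
    then have "measure (M n) N0 \<le> b" using N0(3) by linarith
    with N0(1,2) show ?case by blast
  qed
qed


section \<open>Statistics of the second half under mixing\<close>

context prob_space
begin

text \<open>The lag between the past \<open>{1..n}\<close> and the \<open>\<sigma>\<close>-algebra of the positions from \<open>n + r\<close> on is \<open>r\<close>. The
  statistic starts one position later, so it is measurable for that \<open>\<sigma>\<close>-algebra.\<close>

lemma statistic_weakly_dependent_beta:
  assumes Y: "\<And>j. j \<in> {1..2*n} \<Longrightarrow> Y j \<in> M \<rightarrow>\<^sub>M vec_alg p" and r: "0 < r" "r < n"
    and h: "h \<in> vecs_alg p {1..n - r} \<rightarrow>\<^sub>M borel_alg T" and \<phi>: "\<phi> \<in> BL_ball T"
  shows "(\<lambda>\<omega>. \<phi> (h (sample Y (n + r) (n - r) \<omega>))) \<in> borel_measurable M"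
    and "A \<in> sets (sigma_gen M p Y {1..n}) \<Longrightarrow>
      \<bar>event_cov M A (\<lambda>\<omega>. \<phi> (h (sample Y (n + r) (n - r) \<omega>)))\<bar> \<le> 2 * beta_mix M p Y (2 * n) r"
proof -
  let ?I = "{n + r..2 * n}"
  let ?G = "sigma_gen M p Y ?I"
  have sub: "{n + r + 1..n + r + (n - r)} \<subseteq> ?I" using r by auto
  have YI: "Y j \<in> M \<rightarrow>\<^sub>M vec_alg p" if "j \<in> ?I" for j
    using that r by (intro Y) auto
  note G = sigma_gen_measurable[OF YI]
  have \<xi>: "(\<lambda>\<omega>. \<phi> (h (sample Y (n + r) (n - r) \<omega>))) \<in> borel_measurable ?G"
    unfolding sample_eq_reindex[OF sub]
    by (intro measurable_compose[OF G(1)] measurable_compose[OF reindex_measurable[OF sub]]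
        measurable_compose[OF h] BL_ball_measurable \<phi>)
  show \<xi>M: "(\<lambda>\<omega>. \<phi> (h (sample Y (n + r) (n - r) \<omega>))) \<in> borel_measurable M"
    by (rule measurable_from_subalg[OF G(2) \<xi>])
  have hT: "h (sample Y (n + r) (n - r) \<omega>) \<in> mspace T" if "\<omega> \<in> space M" for \<omega>
    unfolding sample_eq_reindex[OF sub] space_borel_alg[symmetric]
    using that by (intro measurable_space[OF h] measurable_space[OF reindex_measurable[OF sub]]
        measurable_space[OF block_measurable[OF YI]])
  have bound: "\<bar>\<phi> (h (sample Y (n + r) (n - r) \<omega>))\<bar> \<le> 1" if "\<omega> \<in> space M" for \<omega>
    using \<phi> hT[OF that] by (simp add: BL_ball_def)
  assume A: "A \<in> sets (sigma_gen M p Y {1..n})"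
  have F: "subalgebra M (sigma_gen M p Y {1..n})"
    by (rule sigma_gen_measurable(2)) (use Y in auto)
  have "\<bar>event_cov M A (\<lambda>\<omega>. \<phi> (h (sample Y (n + r) (n - r) \<omega>)))\<bar> \<le> 2 * beta_coeff M (sigma_gen M p Y {1..n}) ?G"
    by (rule event_cov_le_beta[OF F G(2) A \<xi> bound])
  also have "beta_coeff M (sigma_gen M p Y {1..n}) ?G \<le> beta_mix M p Y (2 * n) r"
    unfolding beta_mix_def using r by (intro Max_ge) auto
  finally show "\<bar>event_cov M A (\<lambda>\<omega>. \<phi> (h (sample Y (n + r) (n - r) \<omega>)))\<bar> \<le> 2 * beta_mix M p Y (2 * n) r"
    by simp
qed

text \<open>As a function of the block in its original positions, \<open>\<phi>\<close> of the statistic inherits the Lipschitz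
  constant of \<open>h\<close>. This gives its measurability, and the bound through the
  \<open>\<tau>\<close>-coefficient of the block, whose \<open>n - r\<close> observations account for the factor.\<close>

lemma statistic_weakly_dependent_tau:
  assumes Y: "\<And>j. j \<in> {1..2*n} \<Longrightarrow> Y j \<in> M \<rightarrow>\<^sub>M vec_alg p" and r: "0 < r" "r < n"
    and h: "h \<in> space (vecs_alg p {1..n - r}) \<rightarrow> mspace T"
    and lip: "lip_const (vecs_metric p {1..n - r}) T h < top" and \<phi>: "\<phi> \<in> BL_ball T"
  shows "(\<lambda>\<omega>. \<phi> (h (sample Y (n + r) (n - r) \<omega>))) \<in> borel_measurable M"
    and "A \<in> sets (sigma_gen M p Y {1..n}) \<Longrightarrow>
      ennreal \<bar>event_cov M A (\<lambda>\<omega>. \<phi> (h (sample Y (n + r) (n - r) \<omega>)))\<bar>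
        \<le> of_nat (n - r) * tau_mix M p Y (2 * n) r * lip_const (vecs_metric p {1..n - r}) T h"
proof -
  define k where "k = n - r"
  define v where "v = {n + r + 1..2 * n}"
  let ?L = "lip_const (vecs_metric p {1..k}) T h"
  have sub: "{n + r + 1..n + r + k} \<subseteq> v" using r by (auto simp: k_def v_def)
  have v: "finite v" "v \<noteq> {}" "v \<subseteq> {n + r..2 * n}" "card v = k"
    using r by (auto simp: v_def k_def)
  have Yv: "Y j \<in> M \<rightarrow>\<^sub>M vec_alg p" if "j \<in> v" for j
    using that r by (intro Y) (auto simp: v_def)
  define C where "C = enn2real ?L"
  have C: "0 \<le> C" "ennreal C = ?L" using lip by (auto simp: C_def k_def)
  have hlip: "mdist T (h x) (h y) \<le> C * mdist (vecs_metric p {1..k}) x y"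
    if "x \<in> space (vecs_alg p {1..k})" "y \<in> space (vecs_alg p {1..k})" for x y
    using lip_const_le_iff[OF C(1), of "vecs_metric p {1..k}" T h] C(2) that
    by (simp add: mspace_vecs_metric)
  define \<psi> where "\<psi> x = \<phi> (h (reindex (n + r) k x))" for x
  have re: "reindex (n + r) k x \<in> space (vecs_alg p {1..k})" if "x \<in> space (vecs_alg p v)" for x
    by (rule measurable_space[OF reindex_measurable[OF sub] that])
  have hT: "h (reindex (n + r) k x) \<in> mspace T" if "x \<in> space (vecs_alg p v)" for x
    using h re[OF that] by (auto simp: k_def)
  have bound: "\<bar>\<psi> x\<bar> \<le> 1" if "x \<in> space (vecs_alg p v)" for x
    using \<phi> hT[OF that] by (simp add: BL_ball_def \<psi>_def)
  have \<psi>lip: "\<bar>\<psi> x - \<psi> y\<bar> \<le> C * mdist (vecs_metric p v) x y"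
    if "x \<in> space (vecs_alg p v)" "y \<in> space (vecs_alg p v)" for x y
  proof -
    have "\<bar>\<psi> x - \<psi> y\<bar> \<le> mdist T (h (reindex (n + r) k x)) (h (reindex (n + r) k y))"
      using \<phi> hT that by (simp add: BL_ball_def \<psi>_def)
    also have "\<dots> \<le> C * mdist (vecs_metric p {1..k}) (reindex (n + r) k x) (reindex (n + r) k y)"
      by (rule hlip[OF re[OF that(1)] re[OF that(2)]])
    also have "\<dots> \<le> C * mdist (vecs_metric p v) x y"
      by (rule mult_left_mono[OF mdist_reindex_le[OF v(1) sub that] C(1)])
    finally show ?thesis .
  qed
  have \<psi>: "\<psi> \<in> borel_measurable (vecs_alg p v)"
    by (rule lipschitz_vecs_alg_measurable[OF v(1) \<psi>lip])
  have X: "block Y v \<in> M \<rightarrow>\<^sub>M vecs_alg p v" by (rule block_measurable[OF Yv])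
  have eq: "(\<lambda>\<omega>. \<phi> (h (sample Y (n + r) (n - r) \<omega>))) = (\<lambda>\<omega>. \<psi> (block Y v \<omega>))"
    unfolding \<psi>_def sample_eq_reindex[OF sub, symmetric] by (simp add: k_def)
  show "(\<lambda>\<omega>. \<phi> (h (sample Y (n + r) (n - r) \<omega>))) \<in> borel_measurable M"
    unfolding eq by (rule measurable_compose[OF X \<psi>])
  assume A: "A \<in> sets (sigma_gen M p Y {1..n})"
  have F: "subalgebra M (sigma_gen M p Y {1..n})"
    by (rule sigma_gen_measurable(2)) (use Y in auto)
  let ?\<tau> = "\<lambda>l v. tau_coeff M (sigma_gen M p Y {1..l}) (vecs_metric p v) (vecs_alg p v) (block Y v)"
  have sp: "space (vecs_alg p v) = mspace (vecs_metric p v)" by (rule mspace_vecs_metric[OF v(1), symmetric])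
  have "ennreal \<bar>event_cov M A (\<lambda>\<omega>. \<psi> (block Y v \<omega>))\<bar> \<le> ennreal C * ?\<tau> n v"
    by (rule event_cov_le_tau[OF F A X sp \<psi> bound C(1)]) (auto intro!: \<psi>lip simp: sp)
  also have "?\<tau> n v = of_nat k * (?\<tau> n v / of_nat k)"
  proof -
    have "k \<noteq> 0" using r by (simp add: k_def)
    then have "?\<tau> n v * of_nat k / of_nat k = ?\<tau> n v"
      by (intro ennreal_mult_divide_eq) auto
    then show ?thesis by (simp add: ennreal_times_divide mult.commute)
  qed
  also have "?\<tau> n v / of_nat k \<le> tau_mix M p Y (2 * n) r"
  proof -
    have "?\<tau> n v / of_nat k \<le> (MAX v\<in>{v. v \<subseteq> {n + r..2 * n} \<and> v \<noteq> {}}. ?\<tau> n v / of_nat (card v))"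
      using v by (intro Max_ge) auto
    also have "\<dots> \<le> tau_mix M p Y (2 * n) r"
      unfolding tau_mix_def using r by (intro Max_ge) auto
    finally show ?thesis .
  qed
  finally have "ennreal \<bar>event_cov M A (\<lambda>\<omega>. \<psi> (block Y v \<omega>))\<bar> \<le> ennreal C * (of_nat k * tau_mix M p Y (2 * n) r)"
    by (simp add: mult_left_mono)
  then show "ennreal \<bar>event_cov M A (\<lambda>\<omega>. \<phi> (h (sample Y (n + r) (n - r) \<omega>)))\<bar>
        \<le> of_nat (n - r) * tau_mix M p Y (2 * n) r * lip_const (vecs_metric p {1..n - r}) T h"
    unfolding eq C(2) by (simp add: k_def mult_ac)
qed

end

section \<open>Selection among finitely many models\<close>

text \<open>A bound on the outer probability that holds eventually for every level \<open>c\<close> comes with covers that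
  depend on \<open>c\<close>. A single sequence of covers is found by choosing one that is optimal up to \<open>1 / (n + 1)\<close>
  for each \<open>n\<close>.\<close>

lemma vanishing_covers:
  assumes sub: "\<And>n. B n \<subseteq> space (M n)"
    and ev: "\<And>c. 0 < c \<Longrightarrow> \<forall>\<^sub>F n in sequentially. \<exists>N\<in>sets (M n). B n \<subseteq> N \<and> measure (M n) N \<le> c"
  shows "\<exists>N. (\<forall>n. N n \<in> sets (M n) \<and> B n \<subseteq> N n) \<and> (\<lambda>n. measure (M n) (N n)) \<longlonglongrightarrow> 0"
proof -
  define cov where "cov n = {N \<in> sets (M n). B n \<subseteq> N}" for n
  define out where "out n = (INF N\<in>cov n. measure (M n) N)" for n
  have bdd: "bdd_below (measure (M n) ` cov n)" for n by (rule bdd_belowI2[where m=0]) simp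
  have "\<exists>N\<in>cov n. measure (M n) N < out n + 1 / real (Suc n)" for n
  proof -
    have "cov n \<noteq> {}" using sub[of n] by (auto simp: cov_def)
    moreover have "out n < out n + 1 / real (Suc n)" by simp
    ultimately show ?thesis
      using cINF_less_iff[OF _ bdd] unfolding out_def by blast
  qed
  then obtain N where N: "\<And>n. N n \<in> cov n" "\<And>n. measure (M n) (N n) < out n + 1 / real (Suc n)"
    by metis
  have "(\<lambda>n. measure (M n) (N n)) \<longlonglongrightarrow> 0"
  proof (rule order_tendstoI)
    show "\<forall>\<^sub>F n in sequentially. d < measure (M n) (N n)" if "d < 0" for d
      using that by (intro always_eventually allI) (auto intro: less_le_trans)
    fix d :: real assume d: "0 < d"
    have "\<forall>\<^sub>F n in sequentially. \<exists>N\<in>sets (M n). B n \<subseteq> N \<and> measure (M n) N \<le> d / 2"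
      using d by (intro ev) simp
    moreover have "\<forall>\<^sub>F n in sequentially. 1 / real (Suc n) < d / 2"
      using LIMSEQ_inverse_real_of_nat d unfolding inverse_eq_divide
      by (intro order_tendstoD(2)[where y = 0]) auto
    ultimately show "\<forall>\<^sub>F n in sequentially. measure (M n) (N n) < d"
    proof eventually_elim
      case (elim n)
      then obtain N' where "N' \<in> cov n" "measure (M n) N' \<le> d / 2" by (auto simp: cov_def)
      then have "out n \<le> d / 2"
        unfolding out_def using cINF_lower2[OF bdd] by blast
      then show ?case using elim(2) N(2)[of n] by simp
    qed
  qed
  then show ?thesis using N(1) by (auto simp: cov_def)
qed

lemma restrict_space_Int_space: "restrict_space M {\<omega>\<in>space M. P \<omega>} = restrict_space M {\<omega>. P \<omega>}"
proof -
  have "(\<inter>) {\<omega>\<in>space M. P \<omega>} ` sets M = (\<inter>) {\<omega>. P \<omega>} ` sets M"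
    by (rule image_cong[OF refl]) (auto dest: sets.sets_into_space)
  moreover have "{\<omega>\<in>space M. P \<omega>} \<inter> space M = {\<omega>. P \<omega>} \<inter> space M" by auto
  ultimately show ?thesis unfolding restrict_space_def by simp
qed

theorem theorem1:
  fixes M :: "nat \<Rightarrow> 'w measure"
    and p :: "nat \<Rightarrow> nat"
    and Y Yt :: "nat \<Rightarrow> nat \<Rightarrow> 'w \<Rightarrow> nat \<Rightarrow> real"
    and \<M> Mstar :: "'m set"
    and mhat :: "nat \<Rightarrow> 'w \<Rightarrow> 'm"
    and \<Theta> :: "'m \<Rightarrow> 'b metric"
    and \<theta> :: "'m \<Rightarrow> nat \<Rightarrow> nat \<Rightarrow> (nat \<Rightarrow> nat \<Rightarrow> real) \<Rightarrow> 'b"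
    and i :: "'m \<Rightarrow> nat \<Rightarrow> nat"
    and K Kt :: "nat \<Rightarrow> 'w \<Rightarrow> 'b measure"
  assumes prob: "\<And>n. n \<ge> 1 \<Longrightarrow> prob_space (M n)"
    and Y: "\<And>n j. n \<ge> 1 \<Longrightarrow> j \<in> {1..2*n} \<Longrightarrow> Y n j \<in> M n \<rightarrow>\<^sub>M vec_alg (p n)"
    and mhat: "\<And>n. n \<ge> 1 \<Longrightarrow>
          mhat n \<in> sigma_gen (M n) (p n) (Y n) {1..n} \<rightarrow>\<^sub>M sigma \<M> ((\<lambda>m. {m}) ` \<M>)"
    and Theta: "\<And>m. m \<in> \<M> \<Longrightarrow> polish_metric (\<Theta> m)"
    and theta: "\<And>m n k. m \<in> \<M> \<Longrightarrow> n \<ge> 1 \<Longrightarrow> k \<in> {1..n} \<Longrightarrow>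
          \<theta> m n k \<in> space (vecs_alg (p n) {1..k}) \<rightarrow> mspace (\<Theta> m)"
    and theta_measurable: "\<And>m n. m \<in> \<M> \<Longrightarrow> n \<ge> 1 \<Longrightarrow>
          \<theta> m n n \<in> vecs_alg (p n) {1..n} \<rightarrow>\<^sub>M borel_alg (\<Theta> m)"
    and Mstar: "Mstar \<subseteq> \<M>" "finite Mstar"
    and Mstar_prob: "(\<lambda>n. measure (M n) {\<omega>\<in>space (M n). mhat n \<omega> \<in> Mstar}) \<longlonglongrightarrow> 1"
    and i_range: "\<And>m n. m \<in> Mstar \<Longrightarrow> n \<ge> 2 \<Longrightarrow> 0 < i m n \<and> i m n < n"
    and i_lim: "\<And>m. m \<in> Mstar \<Longrightarrow> filterlim (i m) at_top sequentially"
    and A1: "\<And>m. m \<in> Mstar \<Longrightarrow>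
          tight_family {2..} M (\<Theta> m)
            (\<lambda>n \<omega>. \<theta> m n (n - i m n) (sample (Y n) (n + i m n) (n - i m n) \<omega>))"
    and A2: "\<And>m. m \<in> Mstar \<Longrightarrow>
          conv_in_prob_0 M
            (\<lambda>n \<omega>. mdist (\<Theta> m) (\<theta> m n n (sample (Y n) n n \<omega>))
                     (\<theta> m n (n - i m n) (sample (Y n) (n + i m n) (n - i m n) \<omega>)))"
    and T_or_B:
       "((\<forall>n\<ge>1. \<forall>j\<in>{1..2*n}. \<forall>c\<in>{1..p n}. integrable (M n) (\<lambda>\<omega>. Y n j \<omega> c)) \<and>
         (\<forall>m\<in>Mstar.
            (\<forall>\<^sub>F n in sequentially.
               lip_const (vecs_metric (p n) {1..n - i m n}) (\<Theta> m) (\<theta> m n (n - i m n)) < top) \<and>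
            (\<lambda>n. of_nat (n - i m n) * tau_mix (M n) (p n) (Y n) (2*n) (i m n) *
               lip_const (vecs_metric (p n) {1..n - i m n}) (\<Theta> m) (\<theta> m n (n - i m n)))
              \<longlonglongrightarrow> 0))
        \<or>
        (\<forall>m\<in>Mstar.
           (\<forall>n\<ge>2. \<theta> m n (n - i m n) \<in> vecs_alg (p n) {1..n - i m n} \<rightarrow>\<^sub>M borel_alg (\<Theta> m)) \<and>
           (\<lambda>n. beta_mix (M n) (p n) (Y n) (2*n) (i m n)) \<longlonglongrightarrow> 0)"
    and Yt: "\<And>n j. n \<ge> 1 \<Longrightarrow> j \<in> {n+1..2*n} \<Longrightarrow> Yt n j \<in> M n \<rightarrow>\<^sub>M vec_alg (p n)"
    and Yt_copy: "\<And>n. n \<ge> 1 \<Longrightarrow>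
          distr (M n) (vecs_alg (p n) {n+1..2*n}) (block (Yt n) {n+1..2*n}) =
          distr (M n) (vecs_alg (p n) {n+1..2*n}) (block (Y n) {n+1..2*n})"
    and Yt_indep: "\<And>n. n \<ge> 1 \<Longrightarrow>
          prob_space.indep_var (M n)
            (vecs_alg (p n) {n+1..2*n}) (block (Yt n) {n+1..2*n})
            (vecs_alg (p n) {1..2*n}) (block (Y n) {1..2*n})"
    and K: "\<And>n. n \<ge> 1 \<Longrightarrow>
          is_rcd_selected (M n) (sigma_gen (M n) (p n) (Y n) {1..n}) \<M> (mhat n) \<Theta>
            (\<lambda>\<omega>. \<theta> (mhat n \<omega>) n n (sample (Y n) n n \<omega>)) (K n)"
    and Kt: "\<And>n. n \<ge> 1 \<Longrightarrow>
          is_rcd_selected (M n) (sigma_gen (M n) (p n) (Y n) {1..n}) \<M> (mhat n) \<Theta>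
            (\<lambda>\<omega>. \<theta> (mhat n \<omega>) n n (sample (Yt n) n n \<omega>)) (Kt n)"
  shows "conv_in_prob_0 M (\<lambda>n \<omega>. d_BL (\<Theta> (mhat n \<omega>)) (K n \<omega>) (Kt n \<omega>))"
proof -
  define F where "F n = sigma_gen (M n) (p n) (Y n) {1..n}" for n
  define E where "E m n = {\<omega>\<in>space (M n). mhat n \<omega> = m}" for m n
  define X where "X m n \<omega> = \<theta> m n n (sample (Y n) n n \<omega>)" for m n \<omega>
  define Xt where "Xt m n \<omega> = \<theta> m n n (sample (Yt n) n n \<omega>)" for m n \<omega>
  define X' where "X' m n \<omega> = \<theta> m n (n - i m n) (sample (Y n) (n + i m n) (n - i m n) \<omega>)" for m n \<omega>
  have F: "subalgebra (M n) (F n)"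
    "sets (F n) = {block (Y n) {1..n} -` B \<inter> space (M n) |B. B \<in> sets (vecs_alg (p n) {1..n})}"
    if "n \<ge> 1" for n
    unfolding F_def using Y[OF that] by (intro sigma_gen_measurable; simp)+
  have E: "E m n \<in> sets (F n)" if "m \<in> \<M>" "n \<ge> 1" for m n
  proof -
    have "{m} \<in> sets (sigma \<M> ((\<lambda>m. {m}) ` \<M>))"
      using that by (subst sets_measure_of) auto
    from measurable_sets[OF mhat[OF that(2)] this] show ?thesis
      using F(1)[OF that(2)] unfolding E_def F_def subalgebra_def by (simp add: vimage_def Int_def conj_commute)
  qed
  have half: "{n + 1..n + n} \<subseteq> {n + 1..2 * n}" for n :: nat by simp
  have stat: "(\<lambda>x. \<theta> m n n (reindex n n x)) \<in> vecs_alg (p n) {n + 1..2 * n} \<rightarrow>\<^sub>M borel_alg (\<Theta> m)"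
    if "m \<in> \<M>" "n \<ge> 1" for m n
    by (rule measurable_compose[OF reindex_measurable[OF half] theta_measurable[OF that]])
  have bY: "block (Y n) {n + 1..2 * n} \<in> M n \<rightarrow>\<^sub>M vecs_alg (p n) {n + 1..2 * n}"
    "block (Yt n) {n + 1..2 * n} \<in> M n \<rightarrow>\<^sub>M vecs_alg (p n) {n + 1..2 * n}" if "n \<ge> 1" for n
    using Y[OF that] Yt[OF that] by (intro block_measurable; simp)+
  have X_eq: "X m n = (\<lambda>\<omega>. \<theta> m n n (reindex n n (block (Y n) {n + 1..2 * n} \<omega>)))"
    and Xt_eq: "Xt m n = (\<lambda>\<omega>. \<theta> m n n (reindex n n (block (Yt n) {n + 1..2 * n} \<omega>)))" for m n
    by (simp_all add: fun_eq_iff X_def Xt_def sample_eq_reindex[OF half])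
  have sel: "selected_event (M n) (F n) (E m n) (borel_alg (\<Theta> m)) (X m n) (Xt m n) (K n) (Kt n)"
    if m: "m \<in> \<M>" and n: "n \<ge> 1" for m n
  proof -
    have sp: "space (F n) = space (M n)" using F(1)[OF n] by (simp add: subalgebra_def)
    have rM: "restrict_space (M n) {\<omega>. mhat n \<omega> = m} = restrict_space (M n) (E m n)"
      unfolding E_def by (rule restrict_space_Int_space[symmetric])
    have rF: "restrict_space (F n) {\<omega>. mhat n \<omega> = m} = restrict_space (F n) (E m n)"
      unfolding E_def sp[symmetric] by (rule restrict_space_Int_space[symmetric])
    have on_E: "mhat n \<omega> = m" if "\<omega> \<in> space (restrict_space (F n) (E m n))" for \<omega>
      using that by (simp add: space_restrict_space E_def)
    have rcd: "is_rcd (restrict_space (M n) (E m n)) (restrict_space (F n) (E m n)) (borel_alg (\<Theta> m))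
        (\<lambda>\<omega>. \<theta> m n n (sample Z n n \<omega>)) L"
      if "is_rcd_selected (M n) (sigma_gen (M n) (p n) (Y n) {1..n}) \<M> (mhat n) \<Theta>
            (\<lambda>\<omega>. \<theta> (mhat n \<omega>) n n (sample Z n n \<omega>)) L" for Z L
    proof -
      have "is_rcd (restrict_space (M n) (E m n)) (restrict_space (F n) (E m n)) (borel_alg (\<Theta> m))
          (\<lambda>\<omega>. \<theta> (mhat n \<omega>) n n (sample Z n n \<omega>)) L"
        using that m unfolding is_rcd_selected_def F_def[symmetric] rM[symmetric] rF[symmetric] by blast
      then show ?thesis
        by (subst (asm) is_rcd_cong[where X' = "\<lambda>\<omega>. \<theta> m n n (sample Z n n \<omega>)"]) (simp_all add: on_E)
    qed
    interpret prob_space "M n" by (rule prob[OF n])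
    have law: "distr (M n) (borel_alg (\<Theta> m)) (Xt m n) = distr (M n) (borel_alg (\<Theta> m)) (X m n)"
    proof -
      have "distr (M n) (borel_alg (\<Theta> m)) (\<lambda>\<omega>. \<theta> m n n (reindex n n (block Z {n + 1..2 * n} \<omega>)))
          = distr (distr (M n) (vecs_alg (p n) {n + 1..2 * n}) (block Z {n + 1..2 * n})) (borel_alg (\<Theta> m))
              (\<lambda>x. \<theta> m n n (reindex n n x))"
        if "block Z {n + 1..2 * n} \<in> M n \<rightarrow>\<^sub>M vecs_alg (p n) {n + 1..2 * n}" for Z
        using distr_distr[OF stat[OF m n] that] by (simp add: comp_def)
      then show ?thesis using bY[OF n] Yt_copy[OF n] by (simp add: X_eq Xt_eq)
    qed
    show ?thesis
    proof unfold_locales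
      show "X m n \<in> M n \<rightarrow>\<^sub>M borel_alg (\<Theta> m)" "Xt m n \<in> M n \<rightarrow>\<^sub>M borel_alg (\<Theta> m)"
        unfolding X_eq Xt_eq by (rule measurable_compose[OF bY(1)[OF n] stat[OF m n]])
          (rule measurable_compose[OF bY(2)[OF n] stat[OF m n]])
      show "is_rcd (restrict_space (M n) (E m n)) (restrict_space (F n) (E m n)) (borel_alg (\<Theta> m)) (X m n) (K n)"
        "is_rcd (restrict_space (M n) (E m n)) (restrict_space (F n) (E m n)) (borel_alg (\<Theta> m)) (Xt m n) (Kt n)"
        using rcd[OF K[OF n]] rcd[OF Kt[OF n]] by (simp_all add: X_def[abs_def] Xt_def[abs_def])
    qed (use F(1)[OF n] E[OF m n] law in auto)
  qed
  have indep: "event_cov (M n) A (\<lambda>\<omega>. \<phi> (Xt m n \<omega>)) = 0"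
    if m: "m \<in> \<M>" and n: "n \<ge> 1" and \<phi>: "\<phi> \<in> BL_ball (\<Theta> m)" and A: "A \<in> sets (F n)" for m n \<phi> A
  proof -
    interpret prob_space "M n" by (rule prob[OF n])
    obtain B where B: "B \<in> sets (vecs_alg (p n) {1..n})" "A = block (Y n) {1..n} -` B \<inter> space (M n)"
      using A F(2)[OF n] by auto
    have res: "(\<lambda>x. restrict x {1..n}) \<in> vecs_alg (p n) {1..2 * n} \<rightarrow>\<^sub>M vecs_alg (p n) {1..n}"
      unfolding vecs_alg_def by (rule measurable_restrict_subset) auto
    \<comment> \<open>The copy is independent of the whole sequence, so an event of the first half is written as one
      of the whole sequence.\<close>
    define B' where "B' = (\<lambda>x. restrict x {1..n}) -` B \<inter> space (vecs_alg (p n) {1..2 * n})"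
    have B': "B' \<in> sets (vecs_alg (p n) {1..2 * n})"
      unfolding B'_def by (rule measurable_sets[OF res B(1)])
    have b2: "block (Y n) {1..2 * n} \<in> M n \<rightarrow>\<^sub>M vecs_alg (p n) {1..2 * n}"
      using Y[OF n] by (intro block_measurable) auto
    have "restrict (block (Y n) {1..2 * n} \<omega>) {1..n} = block (Y n) {1..n} \<omega>" for \<omega>
      by (auto simp: block_def)
    then have A_eq: "A = block (Y n) {1..2 * n} -` B' \<inter> space (M n)"
      using measurable_space[OF b2] unfolding B(2) B'_def by auto
    show ?thesis
      unfolding A_eq Xt_eq
    proof (rule event_cov_independent[OF Yt_indep[OF n] _ _ B'])
      show "(\<lambda>x. \<phi> (\<theta> m n n (reindex n n x))) \<in> borel_measurable (vecs_alg (p n) {n + 1..2 * n})"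
        by (rule measurable_compose[OF stat[OF m n] BL_ball_measurable[OF \<phi>]])
      show "\<bar>\<phi> (\<theta> m n n (reindex n n x))\<bar> \<le> 1" if "x \<in> space (vecs_alg (p n) {n + 1..2 * n})" for x
        using \<phi> measurable_space[OF stat[OF m n] that] by (simp add: BL_ball_def)
    qed
  qed
  have dep: "\<forall>\<^sub>F n in sequentially. (\<lambda>\<omega>. \<phi> (X' m n \<omega>)) \<in> borel_measurable (M n) \<and>
        (\<forall>A\<in>sets (F n). \<bar>event_cov (M n) A (\<lambda>\<omega>. \<phi> (X' m n \<omega>))\<bar> \<le> c)"
    if m: "m \<in> Mstar" and \<phi>: "\<phi> \<in> BL_ball (\<Theta> m)" and c: "0 < c" for m \<phi> c
  proof -
    have n2: "\<forall>\<^sub>F n in sequentially. 2 \<le> n" by (rule eventually_ge_at_top)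
    have m': "m \<in> \<M>" using m Mstar by auto
    from T_or_B show ?thesis
    proof (elim disjE conjE)
      let ?L = "\<lambda>n. lip_const (vecs_metric (p n) {1..n - i m n}) (\<Theta> m) (\<theta> m n (n - i m n))"
      let ?t = "\<lambda>n. of_nat (n - i m n) * tau_mix (M n) (p n) (Y n) (2*n) (i m n) * ?L n"
      assume T: "\<forall>m\<in>Mstar.
            (\<forall>\<^sub>F n in sequentially.
               lip_const (vecs_metric (p n) {1..n - i m n}) (\<Theta> m) (\<theta> m n (n - i m n)) < top) \<and>
            (\<lambda>n. of_nat (n - i m n) * tau_mix (M n) (p n) (Y n) (2*n) (i m n) *
               lip_const (vecs_metric (p n) {1..n - i m n}) (\<Theta> m) (\<theta> m n (n - i m n)))
              \<longlonglongrightarrow> 0"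
      have "\<forall>\<^sub>F n in sequentially. ?t n < ennreal c"
        using T m c by (intro order_tendstoD(2)[where y = 0]) auto
      moreover have "\<forall>\<^sub>F n in sequentially. ?L n < top" using T m by blast
      ultimately show ?thesis using n2
      proof eventually_elim
        case (elim n)
        have n: "n \<ge> 1" using elim by simp
        interpret prob_space "M n" by (rule prob[OF n])
        have r: "0 < i m n" "i m n < n" using i_range[OF m elim(3)] by auto
        have h: "\<theta> m n (n - i m n) \<in> space (vecs_alg (p n) {1..n - i m n}) \<rightarrow> mspace (\<Theta> m)"
          using r by (intro theta[OF m' n]) auto
        note st = statistic_weakly_dependent_tau[OF _ r h elim(2) \<phi>]
        show ?case
        proof (intro conjI ballI)
          show "(\<lambda>\<omega>. \<phi> (X' m n \<omega>)) \<in> borel_measurable (M n)" unfolding X'_def by (rule st(1)) (rule Y[OF n])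
          fix A assume A: "A \<in> sets (F n)"
          have "ennreal \<bar>event_cov (M n) A (\<lambda>\<omega>. \<phi> (X' m n \<omega>))\<bar> \<le> ?t n"
            unfolding X'_def by (rule st(2)[OF _ A[unfolded F_def]]) (rule Y[OF n])
          then have "ennreal \<bar>event_cov (M n) A (\<lambda>\<omega>. \<phi> (X' m n \<omega>))\<bar> \<le> ennreal c"
            using elim(1) by (meson le_less_trans less_imp_le)
          then show "\<bar>event_cov (M n) A (\<lambda>\<omega>. \<phi> (X' m n \<omega>))\<bar> \<le> c" using c by (simp add: ennreal_le_iff)
        qed
      qed
    next
      assume B: "\<forall>m\<in>Mstar.
           (\<forall>n\<ge>2. \<theta> m n (n - i m n) \<in> vecs_alg (p n) {1..n - i m n} \<rightarrow>\<^sub>M borel_alg (\<Theta> m)) \<and>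
           (\<lambda>n. beta_mix (M n) (p n) (Y n) (2*n) (i m n)) \<longlonglongrightarrow> 0"
      have "\<forall>\<^sub>F n in sequentially. beta_mix (M n) (p n) (Y n) (2*n) (i m n) < c / 2"
        using B m c by (intro order_tendstoD(2)[where y = 0]) auto
      then show ?thesis using n2
      proof eventually_elim
        case (elim n)
        have n: "n \<ge> 1" using elim by simp
        interpret prob_space "M n" by (rule prob[OF n])
        have r: "0 < i m n" "i m n < n" using i_range[OF m elim(2)] by auto
        have h: "\<theta> m n (n - i m n) \<in> vecs_alg (p n) {1..n - i m n} \<rightarrow>\<^sub>M borel_alg (\<Theta> m)"
          using B m elim(2) by blast
        note st = statistic_weakly_dependent_beta[OF _ r h \<phi>]
        show ?case
        proof (intro conjI ballI)
          show "(\<lambda>\<omega>. \<phi> (X' m n \<omega>)) \<in> borel_measurable (M n)" unfolding X'_def by (rule st(1)) (rule Y[OF n])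
          fix A assume A: "A \<in> sets (F n)"
          have "\<bar>event_cov (M n) A (\<lambda>\<omega>. \<phi> (X' m n \<omega>))\<bar> \<le> 2 * beta_mix (M n) (p n) (Y n) (2*n) (i m n)"
            unfolding X'_def by (rule st(2)[OF _ A[unfolded F_def]]) (rule Y[OF n])
          then show "\<bar>event_cov (M n) A (\<lambda>\<omega>. \<phi> (X' m n \<omega>))\<bar> \<le> c" using elim(1) by simp
        qed
      qed
    qed
  qed
  have X'T: "X' m n \<omega> \<in> mspace (\<Theta> m)" if m: "m \<in> Mstar" and n: "n \<ge> 2" and \<omega>: "\<omega> \<in> space (M n)" for m n \<omega>
  proof -
    have "sample (Y n) (n + i m n) (n - i m n) \<omega> \<in> space (vecs_alg (p n) {1..n - i m n})"
    proof -
      have "Y n (n + i m n + j) \<in> M n \<rightarrow>\<^sub>M vec_alg (p n)" if "j \<in> {1..n - i m n}" for j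
        using that n i_range[OF m n] by (intro Y) auto
      then have "(\<lambda>\<omega>. \<lambda>j\<in>{1..n - i m n}. Y n (n + i m n + j) \<omega>) \<in> M n \<rightarrow>\<^sub>M vecs_alg (p n) {1..n - i m n}"
        unfolding vecs_alg_def by (rule measurable_restrict)
      from measurable_space[OF this \<omega>] show ?thesis by (simp add: sample_def)
    qed
    moreover have "\<theta> m n (n - i m n) \<in> space (vecs_alg (p n) {1..n - i m n}) \<rightarrow> mspace (\<Theta> m)"
      using m Mstar n i_range[OF m n] by (intro theta) auto
    ultimately show ?thesis unfolding X'_def by auto
  qed
  have on_event: "\<forall>\<^sub>F n in sequentially. \<exists>N\<in>sets (M n).
      {\<omega>\<in>E m n. \<epsilon> < \<bar>d_BL (\<Theta> m) (K n \<omega>) (Kt n \<omega>)\<bar>} \<subseteq> N \<and> measure (M n) N \<le> b"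
    if m: "m \<in> Mstar" and "0 < \<epsilon>" "0 < b" for m \<epsilon> b
  proof (rule d_BL_vanishes_on_event[where X = "X m" and Xt = "Xt m" and X' = "X' m" and F = F])
    have m': "m \<in> \<M>" using m Mstar by auto
    show "selected_event (M n) (F n) (E m n) (borel_alg (\<Theta> m)) (X m n) (Xt m n) (K n) (Kt n)"
      if "n \<ge> 2" for n using sel[OF m', of n] that by simp
    show "event_cov (M n) A (\<lambda>\<omega>. \<phi> (Xt m n \<omega>)) = 0"
      if "n \<ge> 2" "\<phi> \<in> BL_ball (\<Theta> m)" "A \<in> sets (F n)" for n \<phi> A
      using indep[OF m' _ that(2,3)] that(1) by simp
    show "tight_family {2..} M (\<Theta> m) (X' m)"
      unfolding X'_def[abs_def] by (rule A1[OF m])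
    show "conv_in_prob_0 M (\<lambda>n \<omega>. mdist (\<Theta> m) (X m n \<omega>) (X' m n \<omega>))"
      unfolding X_def X'_def by (rule A2[OF m])
  qed (use dep[OF m] X'T[OF m] that in auto)
  show ?thesis
    unfolding conv_in_prob_0_def
  proof (intro allI impI)
    fix \<epsilon> :: real assume \<epsilon>: "0 < \<epsilon>"
    let ?B = "\<lambda>n. {\<omega>\<in>space (M n). \<epsilon> < \<bar>d_BL (\<Theta> (mhat n \<omega>)) (K n \<omega>) (Kt n \<omega>)\<bar>}"
    show "\<exists>N. (\<forall>n. N n \<in> sets (M n) \<and> ?B n \<subseteq> N n) \<and> (\<lambda>n. measure (M n) (N n)) \<longlonglongrightarrow> 0"
    proof (rule vanishing_covers)
      fix c :: real assume c: "0 < c"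
      define b where "b = c / (2 * (real (card Mstar) + 1))"
      have b: "0 < b" using c by (simp add: b_def)
      have b_le: "card Mstar * b \<le> c / 2" using c by (simp add: b_def field_simps)
      have "\<forall>\<^sub>F n in sequentially. \<forall>m\<in>Mstar. \<exists>N\<in>sets (M n).
          {\<omega>\<in>E m n. \<epsilon> < \<bar>d_BL (\<Theta> m) (K n \<omega>) (Kt n \<omega>)\<bar>} \<subseteq> N \<and> measure (M n) N \<le> b"
        using Mstar(2) on_event \<epsilon> b by (intro eventually_ball_finite) auto
      moreover have "\<forall>\<^sub>F n in sequentially. 1 - c / 2 < measure (M n) {\<omega>\<in>space (M n). mhat n \<omega> \<in> Mstar}"
        using Mstar_prob c by (intro order_tendstoD(1)) auto
      moreover have "\<forall>\<^sub>F n in sequentially. 1 \<le> n" by (rule eventually_ge_at_top)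
      ultimately show "\<forall>\<^sub>F n in sequentially. \<exists>N\<in>sets (M n). ?B n \<subseteq> N \<and> measure (M n) N \<le> c"
      proof eventually_elim
        case (elim n)
        interpret prob_space "M n" by (rule prob[OF elim(3)])
        let ?S = "{\<omega>\<in>space (M n). mhat n \<omega> \<in> Mstar}"
        obtain N where N: "\<And>m. m \<in> Mstar \<Longrightarrow> N m \<in> sets (M n) \<and>
            {\<omega>\<in>E m n. \<epsilon> < \<bar>d_BL (\<Theta> m) (K n \<omega>) (Kt n \<omega>)\<bar>} \<subseteq> N m \<and> measure (M n) (N m) \<le> b"
          using elim(1) by metis
        have "E m n \<in> sets (M n)" if "m \<in> Mstar" for m
          using E[of m n] that Mstar(1) elim(3) F(1)[OF elim(3)] by (auto simp: subalgebra_def)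
        then have "(\<Union>m\<in>Mstar. E m n) \<in> sets (M n)" using Mstar(2) by (intro sets.finite_UN) auto
        moreover have "(\<Union>m\<in>Mstar. E m n) = ?S" by (auto simp: E_def)
        ultimately have S: "?S \<in> sets (M n)" by simp
        have UN: "(\<Union>m\<in>Mstar. N m) \<in> sets (M n)" using N Mstar(2) by (intro sets.finite_UN) auto
        have "measure (M n) ((space (M n) - ?S) \<union> (\<Union>m\<in>Mstar. N m))
            \<le> measure (M n) (space (M n) - ?S) + measure (M n) (\<Union>m\<in>Mstar. N m)"
          using S UN by (intro measure_Un_le) auto
        also have "measure (M n) (\<Union>m\<in>Mstar. N m) \<le> (\<Sum>m\<in>Mstar. measure (M n) (N m))"
          using N Mstar(2) by (intro measure_UNION_le) auto
        also have "\<dots> \<le> card Mstar * b"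
          using N by (intro sum_bounded_above) auto
        finally have "measure (M n) ((space (M n) - ?S) \<union> (\<Union>m\<in>Mstar. N m)) \<le> c"
          using elim(2) b_le prob_compl[OF S] by simp
        moreover have "?B n \<subseteq> (space (M n) - ?S) \<union> (\<Union>m\<in>Mstar. N m)"
          using N unfolding E_def by blast
        ultimately show ?case using S UN by (intro bexI[of _ "(space (M n) - ?S) \<union> (\<Union>m\<in>Mstar. N m)"]) auto
      qed
    qed auto
  qed
qed

end
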